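(* Let $n\ge 3$ be odd and let the inter-agent graph be the undirected ring, $\mathcal N_i=\{i-1,i+1\}$ for all $i\in\mathcal V$ (indices modulo $n$). Consider the closed-loop system on $(\mathcal S^2)^n$ $$\dot\Gamma_i=\Gamma_i\times\Big(\Gamma_i\times\sum_{j\in\mathcal N_i}\Gamma_j\Big),\qquad i=1,\dots,n.$$ Then, as time tends to infinity, every trajectory of this system approaches one of its equilibrium manifolds, among which $$\mathcal M_o=\{\mathbf\Gamma\in(\mathcal S^2)^n:\ \exists u,v\in\mathcal S^2,\ u^Tv=0,\ \Gamma_i=\exp\big((i-1)(\pi-\pi/n)\widehat u\big)v\ \ \forall i\in\mathcal V\}$$ is the only stable one.
   Context: $\mathcal S^2=\{x\in\mathbb R^3:\|x\|=1\}$, $\mathcal V=\{1,\dots,n\}$, and indices are taken modulo $n$ (so $n+1$ means $1$ and $0$ means $n$). For $x\in\mathbb R^3$, $\widehat x$ is the skew-symmetric matrix with $\widehat x y=x\times y$ for all $y\in\mathbb R^3$, and $\exp$ is the matrix exponential. Points of $(\mathcal S^2)^n$ are written $\mathbf\Gamma=\{\Gamma_i\}_{i\in\mathcal V}$. The metric is $d_{(\mathcal S^2)^n}(\mathbf\Gamma,\bar{\mathbf\Gamma})=\max_i\arccos(\Gamma_i^T\bar\Gamma_i)$, and $d_{\mathcal M}(\mathbf\Gamma)=\inf_{\bar{\mathbf\Gamma}\in\mathcal M}d_{(\mathcal S^2)^n}(\mathbf\Gamma,\bar{\mathbf\Gamma})$. The equilibrium manifolds of the system are the connected components of its set of equilibria.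 A trajectory approaches a set $\mathcal M$ if $d_{\mathcal M}(\mathbf\Gamma(t))\to0$ as $t\to\infty$. A positively invariant set $\mathcal M$ is stable if for every $\varepsilon>0$ there is $\delta>0$ such that $d_{\mathcal M}(\mathbf\Gamma(0))<\delta$ implies $d_{\mathcal M}(\mathbf\Gamma(t))<\varepsilon$ for all $t\ge0$. *)

theory Defs
  imports "HOL-Analysis.Analysis"
begin

text \<open>
  A configuration of \<open>n\<close> agents is a function on \<open>{1..n}\<close> that is extended by \<^const>\<open>undefined\<close>
  outside that set, so that the product topology on \<open>nat \<Rightarrow> real^3\<close> restricts to the topology of
  the \<open>n\<close>-fold product of spheres, which is also the topology of \<open>dist_S2n\<close> below.
\<close>

definition S2n :: "nat \<Rightarrow> (nat \<Rightarrow> real^3) set" where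
  "S2n n = PiE {1..n} (\<lambda>_. sphere 0 1)"

definition dist_S2n :: "nat \<Rightarrow> (nat \<Rightarrow> real^3) \<Rightarrow> (nat \<Rightarrow> real^3) \<Rightarrow> real" where
  "dist_S2n n \<Gamma> \<Delta> = Max ((\<lambda>i. arccos (\<Gamma> i \<bullet> \<Delta> i)) ` {1..n})"

definition dist_set :: "nat \<Rightarrow> (nat \<Rightarrow> real^3) set \<Rightarrow> (nat \<Rightarrow> real^3) \<Rightarrow> real" where
  "dist_set n M \<Gamma> = (INF \<Delta>\<in>M. dist_S2n n \<Gamma> \<Delta>)"

definition ring_nbrs :: "nat \<Rightarrow> nat \<Rightarrow> nat set" where
  "ring_nbrs n i = {if i = 1 then n else i - 1, if i = n then 1 else i + 1}"

definition ring_field :: "nat \<Rightarrow> (nat \<Rightarrow> real^3) \<Rightarrow> nat \<Rightarrow> real^3" where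
  "ring_field n \<Gamma> i = cross3 (\<Gamma> i) (cross3 (\<Gamma> i) (\<Sum>j\<in>ring_nbrs n i. \<Gamma> j))"

text \<open>Trajectories are forward solutions; their values at negative times are irrelevant.\<close>

definition trajectory :: "nat \<Rightarrow> (real \<Rightarrow> nat \<Rightarrow> real^3) \<Rightarrow> bool" where
  "trajectory n \<Gamma> \<longleftrightarrow>
     (\<forall>t\<ge>0. \<Gamma> t \<in> S2n n) \<and>
     (\<forall>t\<ge>0. \<forall>i\<in>{1..n}.
        ((\<lambda>s. \<Gamma> s i) has_vector_derivative ring_field n (\<Gamma> t) i) (at t within {0..}))"

definition equilibria :: "nat \<Rightarrow> (nat \<Rightarrow> real^3) set" where
  "equilibria n = {\<Gamma> \<in> S2n n. \<forall>i\<in>{1..n}. ring_field n \<Gamma> i = 0}"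

definition equilibrium_manifolds :: "nat \<Rightarrow> (nat \<Rightarrow> real^3) set set" where
  "equilibrium_manifolds n = components (equilibria n)"

definition approaches :: "nat \<Rightarrow> (real \<Rightarrow> nat \<Rightarrow> real^3) \<Rightarrow> (nat \<Rightarrow> real^3) set \<Rightarrow> bool" where
  "approaches n \<Gamma> M \<longleftrightarrow> ((\<lambda>t. dist_set n M (\<Gamma> t)) \<longlongrightarrow> 0) at_top"

definition positively_invariant :: "nat \<Rightarrow> (nat \<Rightarrow> real^3) set \<Rightarrow> bool" where
  "positively_invariant n M \<longleftrightarrow>
     (\<forall>\<Gamma>. trajectory n \<Gamma> \<longrightarrow> \<Gamma> 0 \<in> M \<longrightarrow> (\<forall>t\<ge>0. \<Gamma> t \<in> M))"

text \<open>
  For a nonempty closed \<open>M\<close>, such as an equilibrium manifold, positive invariance already follows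
  from the second conjunct, so a failure of stability is always a failure of the second conjunct.
\<close>

definition is_stable :: "nat \<Rightarrow> (nat \<Rightarrow> real^3) set \<Rightarrow> bool" where
  "is_stable n M \<longleftrightarrow>
     positively_invariant n M \<and>
     (\<forall>\<epsilon>>0. \<exists>\<delta>>0. \<forall>\<Gamma>. trajectory n \<Gamma> \<longrightarrow> dist_set n M (\<Gamma> 0) < \<delta> \<longrightarrow>
        (\<forall>t\<ge>0. dist_set n M (\<Gamma> t) < \<epsilon>))"

definition hat :: "real^3 \<Rightarrow> real^3^3" where
  "hat x = matrix (cross3 x)"

lemma hat_mult_vec: "hat x *v y = cross3 x y"
  unfolding hat_def
  by (rule matrix_works) (simp add: Vector_Spaces.linear_iff cross_add_right cross_mult_right scalar_mult_eq_scaleR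
      real_vector.vector_space_axioms)

text \<open>
  The function \<^const>\<open>exp\<close> is not available here, since \<open>real^3^3\<close> is not an instance of
  \<^class>\<open>real_normed_algebra_1\<close> with respect to the matrix product.
\<close>

definition matrix_exp :: "real^3^3 \<Rightarrow> real^3^3" where
  "matrix_exp A = (\<Sum>k. (1 / fact k) *\<^sub>R (((**) A) ^^ k) (mat 1))"

definition M_o :: "nat \<Rightarrow> (nat \<Rightarrow> real^3) set" where
  "M_o n = {\<Gamma> \<in> S2n n. \<exists>u\<in>sphere 0 1. \<exists>v\<in>sphere 0 1. u \<bullet> v = 0 \<and>
     (\<forall>i\<in>{1..n}. \<Gamma> i = matrix_exp (((real i - 1) * (pi - pi / real n)) *\<^sub>R hat u) *v v)}"

end

theory Submission
  imports Defs
begin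

text \<open>
  The field is minus the Riemannian gradient of the energy \<open>V = \<Sum> \<Gamma>\<^sub>i \<bullet> \<Gamma>\<^sub>i\<^sub>+\<^sub>1\<close>: neighbours repel, and the
  energy decreases at the rate of the sum of the squared speeds. Everything rests on three facts.

  First, the equilibria are explicit. At an equilibrium \<open>\<Gamma>\<^sub>i\<^sub>-\<^sub>1 + \<Gamma>\<^sub>i\<^sub>+\<^sub>1\<close> is a multiple of \<open>\<Gamma>\<^sub>i\<close>, so all
  agents lie in one plane, and the edge cosines \<open>c\<^sub>i = \<Gamma>\<^sub>i \<bullet> \<Gamma>\<^sub>i\<^sub>+\<^sub>1\<close> agree up to sign. The vector of edge
  cosines determines the configuration up to a rotation (\<open>equilibrium_planar\<close>). The ring has to close up, and
  since \<open>n\<close> is odd this leaves only finitely many values for the \<open>c\<^sub>i\<close>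
  (\<open>edge_cos_mem_equilibrium_cosines\<close>). Hence the connected components of the set of equilibria are the
  fibres of the map that takes an equilibrium to its edge cosines
  (\<open>connected_component_equilibria\<close>), and \<open>M_o\<close> is the fibre where all \<open>c\<^sub>i\<close> equal \<open>cos (\<pi> - \<pi> / n)\<close>.

  Second, every trajectory approaches a single fibre. The energy is bounded below and the dissipation is
  Lipschitz along the trajectory, so the dissipation tends to \<open>0\<close> (\<open>dissipation_tendsto_0\<close>), and by compactness
  the trajectory comes close to the set of equilibria. Its edge cosines are continuous in time and come close
  to a finite set, so each of them converges.

  Third, an equilibrium outside \<open>M_o\<close> is not a local minimum of the energy: suitable displacements
  orthogonal to its plane have a negative second variation (\<open>not_M_o_lower_energy_nearby\<close>). So the minimizers
  of the energy are exactly the elements of \<open>M_o\<close>, and the energy is a Lyapunov function for \<open>M_o\<close>. A trajectory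
  that starts close to another fibre with less energy than that fibre has to approach a fibre
  whose energy is smaller by at least a fixed amount, so that fibre is unstable. This last step uses that a trajectory
  starts at every configuration (\<open>trajectory_exists\<close>).
\<close>

section \<open>The ring and its energy\<close>

definition next_idx :: "nat \<Rightarrow> nat \<Rightarrow> nat" where
  "next_idx n i = (if i = n then 1 else i + 1)"

definition prev_idx :: "nat \<Rightarrow> nat \<Rightarrow> nat" where
  "prev_idx n i = (if i = 1 then n else i - 1)"

definition edge_cos :: "nat \<Rightarrow> (nat \<Rightarrow> real^3) \<Rightarrow> nat \<Rightarrow> real" where
  "edge_cos n \<Gamma> i = \<Gamma> i \<bullet> \<Gamma> (next_idx n i)"

definition energy :: "nat \<Rightarrow> (nat \<Rightarrow> real^3) \<Rightarrow> real" where
  "energy n \<Gamma> = (\<Sum>i\<in>{1..n}. edge_cos n \<Gamma> i)"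

definition dissipation :: "nat \<Rightarrow> (nat \<Rightarrow> real^3) \<Rightarrow> real" where
  "dissipation n \<Gamma> = (\<Sum>i\<in>{1..n}. (norm (ring_field n \<Gamma> i))\<^sup>2)"

lemma next_idx_mem: "i \<in> {1..n} \<Longrightarrow> next_idx n i \<in> {1..n}"
  and prev_idx_mem: "i \<in> {1..n} \<Longrightarrow> prev_idx n i \<in> {1..n}"
  and next_prev_idx: "i \<in> {1..n} \<Longrightarrow> next_idx n (prev_idx n i) = i"
  and prev_next_idx: "i \<in> {1..n} \<Longrightarrow> prev_idx n (next_idx n i) = i"
  by (auto simp: next_idx_def prev_idx_def)

lemma bij_betw_next_idx: "bij_betw (next_idx n) {1..n} {1..n}"
  by (rule bij_betw_byWitness[where f' = "prev_idx n"])
     (use next_idx_mem prev_idx_mem next_prev_idx prev_next_idx in blast)+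

lemma sum_next_idx: "(\<Sum>i\<in>{1..n}. h (next_idx n i)) = (\<Sum>i\<in>{1..n}. h i)"
  by (rule sum.reindex_bij_betw[OF bij_betw_next_idx])

lemma sum_prev_idx:
  "(\<Sum>i\<in>{1..n}. h (prev_idx n i) i) = (\<Sum>i\<in>{1..n}. h i (next_idx n i))"
proof -
  have "(\<Sum>i\<in>{1..n}. h (prev_idx n i) i)
      = (\<Sum>i\<in>{1..n}. h (prev_idx n (next_idx n i)) (next_idx n i))"
    by (rule sum_next_idx[symmetric])
  then show ?thesis by (simp add: prev_next_idx)
qed

lemma S2n_norm: "\<Gamma> \<in> S2n n \<Longrightarrow> i \<in> {1..n} \<Longrightarrow> norm (\<Gamma> i) = 1"
  unfolding S2n_def by (auto dest: PiE_mem)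

lemma S2n_inner_self: "\<Gamma> \<in> S2n n \<Longrightarrow> i \<in> {1..n} \<Longrightarrow> \<Gamma> i \<bullet> \<Gamma> i = 1"
  using S2n_norm by (auto simp: norm_eq_1)

lemma sum_ring_nbrs:
  assumes "n \<ge> 3" "i \<in> {1..n}"
  shows "(\<Sum>j\<in>ring_nbrs n i. \<Gamma> j) = \<Gamma> (prev_idx n i) + \<Gamma> (next_idx n i)"
  using assms unfolding ring_nbrs_def prev_idx_def next_idx_def by auto

lemma cross3_cross3_unit:
  assumes "norm x = 1"
  shows "cross3 x (cross3 x s) = (x \<bullet> s) *\<^sub>R x - s"
  using assms by (simp add: Lagrange norm_eq_1)

text \<open>The double cross product with a unit vector is minus the projection to its orthogonal complement, so the
  field is minus the Riemannian gradient of the energy.\<close>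
lemma ring_field_eq:
  assumes "n \<ge> 3" "\<Gamma> \<in> S2n n" "i \<in> {1..n}"
  shows "ring_field n \<Gamma> i = (edge_cos n \<Gamma> (prev_idx n i) + edge_cos n \<Gamma> i) *\<^sub>R \<Gamma> i
           - (\<Gamma> (prev_idx n i) + \<Gamma> (next_idx n i))"
proof -
  have "\<Gamma> i \<bullet> (\<Gamma> (prev_idx n i) + \<Gamma> (next_idx n i)) = edge_cos n \<Gamma> (prev_idx n i) + edge_cos n \<Gamma> i"
    unfolding edge_cos_def next_prev_idx[OF assms(3)] inner_add_right
    by (simp only: inner_commute[of "\<Gamma> i" "\<Gamma> (prev_idx n i)"])
  then show ?thesis
    by (simp only: ring_field_def sum_ring_nbrs[OF assms(1,3)] cross3_cross3_unit[OF S2n_norm[OF assms(2,3)]])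
qed

text \<open>The field is minus the projection of the sum of the neighbours to the tangent plane. The left-hand side is the
  contribution of agent \<open>i\<close> to the rate of change of the energy.\<close>
lemma ring_field_inner:
  assumes "n \<ge> 3" "\<Gamma> \<in> S2n n" "i \<in> {1..n}"
  shows "ring_field n \<Gamma> i \<bullet> (\<Gamma> (prev_idx n i) + \<Gamma> (next_idx n i)) = - (norm (ring_field n \<Gamma> i))\<^sup>2"
proof -
  define s where "s = \<Gamma> (prev_idx n i) + \<Gamma> (next_idx n i)"
  have eq: "ring_field n \<Gamma> i = (\<Gamma> i \<bullet> s) *\<^sub>R \<Gamma> i - s"
    using assms by (simp add: ring_field_def sum_ring_nbrs cross3_cross3_unit S2n_norm s_def)
  have "\<Gamma> i \<bullet> \<Gamma> i = 1" by (rule S2n_inner_self[OF assms(2,3)])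
  then show ?thesis
    unfolding s_def[symmetric] eq power2_norm_eq_inner
    by (simp add: algebra_simps inner_commute)
qed

lemma norm_cross3_le: "norm (cross3 x y) \<le> norm x * norm y"
proof -
  have "(norm (cross3 x y))\<^sup>2 \<le> (norm x * norm y)\<^sup>2"
    unfolding norm_cross_dot[of x y, symmetric] by simp
  then show ?thesis by (rule power2_le_imp_le) simp
qed

lemma norm_ring_field_le:
  assumes "n \<ge> 3" "i \<in> {1..n}" "\<And>j. j \<in> {1..n} \<Longrightarrow> norm (\<Gamma> j) \<le> 1"
  shows "norm (ring_field n \<Gamma> i) \<le> 2"
proof -
  define s where "s = \<Gamma> (prev_idx n i) + \<Gamma> (next_idx n i)"
  have s: "norm s \<le> 2"
    unfolding s_def
    using norm_triangle_le[of "\<Gamma> (prev_idx n i)" "\<Gamma> (next_idx n i)" 2]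
      assms(3)[OF prev_idx_mem[OF assms(2)]] assms(3)[OF next_idx_mem[OF assms(2)]] by simp
  have "norm (cross3 (\<Gamma> i) s) \<le> 1 * 2"
    by (rule order.trans[OF norm_cross3_le mult_mono]) (use s assms in auto)
  then have "norm (cross3 (\<Gamma> i) (cross3 (\<Gamma> i) s)) \<le> 1 * 2"
    by (intro order.trans[OF norm_cross3_le mult_mono]) (use assms in auto)
  then show ?thesis
    using assms by (simp add: ring_field_def sum_ring_nbrs s_def)
qed

lemma ring_field_lipschitz:
  assumes "n \<ge> 3" "i \<in> {1..n}"
    and "\<And>j. j \<in> {1..n} \<Longrightarrow> norm (\<Gamma> j) \<le> 1" "\<And>j. j \<in> {1..n} \<Longrightarrow> norm (\<Delta> j) \<le> 1"
    and d: "\<And>j. j \<in> {1..n} \<Longrightarrow> norm (\<Gamma> j - \<Delta> j) \<le> d"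
  shows "norm (ring_field n \<Gamma> i - ring_field n \<Delta> i) \<le> 6 * d"
proof -
  define x where "x = \<Gamma> i"
  define y where "y = \<Delta> i"
  define s where "s = \<Gamma> (prev_idx n i) + \<Gamma> (next_idx n i)"
  define r where "r = \<Delta> (prev_idx n i) + \<Delta> (next_idx n i)"
  note m = assms(2) prev_idx_mem[OF assms(2)] next_idx_mem[OF assms(2)]
  have s: "norm s \<le> 2" and r: "norm r \<le> 2"
    unfolding s_def r_def
    using norm_triangle_le[of "\<Gamma> (prev_idx n i)" "\<Gamma> (next_idx n i)" 2]
      norm_triangle_le[of "\<Delta> (prev_idx n i)" "\<Delta> (next_idx n i)" 2]
      assms(3,4)[OF m(2)] assms(3,4)[OF m(3)] by auto
  have sr: "norm (s - r) \<le> 2 * d"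
    using norm_triangle_ineq[of "\<Gamma> (prev_idx n i) - \<Delta> (prev_idx n i)" "\<Gamma> (next_idx n i) - \<Delta> (next_idx n i)"]
      d[OF m(2)] d[OF m(3)] unfolding s_def r_def by (simp add: algebra_simps)
  have x: "norm x \<le> 1" and y: "norm y \<le> 1" and xy: "norm (x - y) \<le> d"
    using assms m unfolding x_def y_def by auto
  have d0: "d \<ge> 0" using xy norm_ge_zero order.trans by blast
  have split: "cross3 x (cross3 x s) - cross3 y (cross3 y r)
      = cross3 (x - y) (cross3 x s) + cross3 y (cross3 (x - y) s) + cross3 y (cross3 y (s - r))"
    by (simp add: cross3_simps)
  have cr: "norm (cross3 a b) \<le> A * B" if "norm a \<le> A" "norm b \<le> B" for a b A B
    using that by (meson norm_cross3_le mult_mono norm_ge_zero order.trans)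
  have 1: "norm (cross3 (x - y) (cross3 x s)) \<le> d * (1 * 2)"
    by (intro cr xy x s)
  have 2: "norm (cross3 y (cross3 (x - y) s)) \<le> 1 * (d * 2)"
    by (intro cr xy y s)
  have 3: "norm (cross3 y (cross3 y (s - r))) \<le> 1 * (1 * (2 * d))"
    by (intro cr y sr)
  have "norm (cross3 x (cross3 x s) - cross3 y (cross3 y r)) \<le> 6 * d"
    unfolding split
    using 1 2 3 norm_triangle_ineq[of "cross3 (x - y) (cross3 x s) + cross3 y (cross3 (x - y) s)" "cross3 y (cross3 y (s - r))"]
      norm_triangle_ineq[of "cross3 (x - y) (cross3 x s)" "cross3 y (cross3 (x - y) s)"] by linarith
  then show ?thesis
    using assms by (simp add: ring_field_def sum_ring_nbrs s_def r_def x_def y_def)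
qed

lemma abs_edge_cos_le_1:
  assumes "\<Gamma> \<in> S2n n" "i \<in> {1..n}"
  shows "\<bar>edge_cos n \<Gamma> i\<bar> \<le> 1"
  unfolding edge_cos_def
  using Cauchy_Schwarz_ineq2[of "\<Gamma> i" "\<Gamma> (next_idx n i)"]
  by (simp add: S2n_norm[OF assms] S2n_norm[OF assms(1) next_idx_mem[OF assms(2)]])

lemma energy_ge: "\<Gamma> \<in> S2n n \<Longrightarrow> energy n \<Gamma> \<ge> - real n"
  using sum_mono[of "{1..n}" "\<lambda>_. - 1" "edge_cos n \<Gamma>"] abs_edge_cos_le_1
  unfolding energy_def by (fastforce simp: abs_le_iff)

lemma dissipation_nonneg: "dissipation n \<Gamma> \<ge> 0"
  unfolding dissipation_def by (intro sum_nonneg) simp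

lemma equilibria_iff_dissipation:
  "\<Gamma> \<in> equilibria n \<longleftrightarrow> \<Gamma> \<in> S2n n \<and> dissipation n \<Gamma> = 0"
  unfolding equilibria_def dissipation_def by (subst sum_nonneg_eq_0_iff) auto

section \<open>The metric and the topology\<close>

text \<open>The product over the agents is a product over all natural numbers, with singleton factors outside the
  ring, so Tychonoff's theorem applies.\<close>
lemma compact_S2n: "compact (S2n n)"
proof -
  have eq: "S2n n = PiE UNIV (\<lambda>i. if i \<in> {1..n} then sphere 0 1 else {undefined})"
    unfolding S2n_def PiE_def Pi_def extensional_def by (auto split: if_splits)
  have "compactin (product_topology (\<lambda>_. euclidean) UNIV) (S2n n)"
    unfolding eq compactin_PiE by (simp add: compactin_euclidean_iff)
  then show ?thesis
    by (simp add: euclidean_product_topology)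
qed

lemma continuous_on_edge_cos: "continuous_on S (\<lambda>\<Gamma>. edge_cos n \<Gamma> i)"
  unfolding edge_cos_def
  by (intro continuous_intros continuous_on_subset[OF continuous_on_product_coordinates]) auto

lemma continuous_on_energy: "continuous_on S (energy n)"
  unfolding energy_def by (intro continuous_on_sum continuous_on_edge_cos)

lemma continuous_on_dissipation: "continuous_on S (dissipation n)"
  unfolding dissipation_def ring_field_def
  by (intro continuous_on_sum continuous_intros continuous_on_cross
      continuous_on_subset[OF continuous_on_product_coordinates]) auto

lemma dist_S2n_le_iff:
  "n \<ge> 3 \<Longrightarrow> dist_S2n n \<Gamma> \<Delta> \<le> e \<longleftrightarrow> (\<forall>i\<in>{1..n}. arccos (\<Gamma> i \<bullet> \<Delta> i) \<le> e)"
  unfolding dist_S2n_def by (subst Max_le_iff) auto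

lemma dist_S2n_less_iff:
  "n \<ge> 3 \<Longrightarrow> dist_S2n n \<Gamma> \<Delta> < e \<longleftrightarrow> (\<forall>i\<in>{1..n}. arccos (\<Gamma> i \<bullet> \<Delta> i) < e)"
  unfolding dist_S2n_def by (subst Max_less_iff) auto

lemma abs_inner_S2n_le:
  assumes "\<Gamma> \<in> S2n n" "\<Delta> \<in> S2n n" "i \<in> {1..n}"
  shows "\<bar>\<Gamma> i \<bullet> \<Delta> i\<bar> \<le> 1"
  using Cauchy_Schwarz_ineq2[of "\<Gamma> i" "\<Delta> i"]
  by (simp add: S2n_norm[OF assms(1,3)] S2n_norm[OF assms(2,3)])

lemma dist_S2n_nonneg:
  assumes "n \<ge> 3" "\<Gamma> \<in> S2n n" "\<Delta> \<in> S2n n"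
  shows "dist_S2n n \<Gamma> \<Delta> \<ge> 0"
proof -
  have "1 \<in> {1..n}" using assms by auto
  then have "0 \<le> arccos (\<Gamma> 1 \<bullet> \<Delta> 1)"
    using abs_inner_S2n_le[OF assms(2,3)] by (intro arccos_lbound) (auto simp: abs_le_iff)
  also have "\<dots> \<le> dist_S2n n \<Gamma> \<Delta>"
    unfolding dist_S2n_def using \<open>1 \<in> {1..n}\<close> by (intro Max_ge) auto
  finally show ?thesis .
qed

text \<open>The chord is at most as long as the arc.\<close>
lemma norm_diff_le_arccos:
  fixes x y :: "'a :: real_inner"
  assumes "norm x = 1" "norm y = 1"
  shows "norm (x - y) \<le> arccos (x \<bullet> y)"
proof -
  define t where "t = arccos (x \<bullet> y)"
  have b: "\<bar>x \<bullet> y\<bar> \<le> 1" using Cauchy_Schwarz_ineq2[of x y] assms by simp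
  then have t: "0 \<le> t" "t \<le> pi" "cos t = x \<bullet> y"
    unfolding t_def by (auto simp: abs_le_iff arccos_lbound arccos_ubound)
  have "(norm (x - y))\<^sup>2 = 2 - 2 * cos t"
    using assms t(3) by (simp add: power2_norm_eq_inner inner_diff_left inner_diff_right
        inner_commute norm_eq_1)
  also have "\<dots> = (2 * sin (t / 2))\<^sup>2"
    using cos_double_sin[of "t / 2"] by (simp add: power_mult_distrib)
  also have "\<dots> \<le> t\<^sup>2"
    using sin_x_le_x[of "t / 2"] sin_ge_zero[of "t / 2"] t by (intro power_mono) auto
  finally show ?thesis
    using t(1) unfolding t_def by (rule power2_le_imp_le)
qed

lemma abs_edge_cos_diff_le:
  assumes "n \<ge> 3" "\<Gamma> \<in> S2n n" "\<Delta> \<in> S2n n" "i \<in> {1..n}"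
  shows "\<bar>edge_cos n \<Gamma> i - edge_cos n \<Delta> i\<bar> \<le> 2 * dist_S2n n \<Gamma> \<Delta>"
proof -
  let ?j = "next_idx n i"
  have d: "norm (\<Gamma> k - \<Delta> k) \<le> dist_S2n n \<Gamma> \<Delta>" if "k \<in> {1..n}" for k
    using norm_diff_le_arccos[OF S2n_norm[OF assms(2) that] S2n_norm[OF assms(3) that]]
      dist_S2n_le_iff[OF assms(1), of \<Gamma> \<Delta> "dist_S2n n \<Gamma> \<Delta>"] that by (meson order.refl order.trans)
  have "edge_cos n \<Gamma> i - edge_cos n \<Delta> i = (\<Gamma> i - \<Delta> i) \<bullet> \<Gamma> ?j + \<Delta> i \<bullet> (\<Gamma> ?j - \<Delta> ?j)"
    by (simp add: edge_cos_def inner_diff_left inner_diff_right)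
  moreover have "\<bar>(\<Gamma> i - \<Delta> i) \<bullet> \<Gamma> ?j\<bar> \<le> norm (\<Gamma> i - \<Delta> i)"
    using Cauchy_Schwarz_ineq2[of "\<Gamma> i - \<Delta> i" "\<Gamma> ?j"] S2n_norm[OF assms(2) next_idx_mem[OF assms(4)]] by simp
  moreover have "\<bar>\<Delta> i \<bullet> (\<Gamma> ?j - \<Delta> ?j)\<bar> \<le> norm (\<Gamma> ?j - \<Delta> ?j)"
    using Cauchy_Schwarz_ineq2[of "\<Delta> i" "\<Gamma> ?j - \<Delta> ?j"] S2n_norm[OF assms(3,4)] by simp
  ultimately show ?thesis
    using d[OF assms(4)] d[OF next_idx_mem[OF assms(4)]] by linarith
qed

lemma abs_energy_diff_le:
  assumes "n \<ge> 3" "\<Gamma> \<in> S2n n" "\<Delta> \<in> S2n n"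
  shows "\<bar>energy n \<Gamma> - energy n \<Delta>\<bar> \<le> 2 * real n * dist_S2n n \<Gamma> \<Delta>"
proof -
  have "\<bar>energy n \<Gamma> - energy n \<Delta>\<bar> \<le> (\<Sum>i\<in>{1..n}. \<bar>edge_cos n \<Gamma> i - edge_cos n \<Delta> i\<bar>)"
    unfolding energy_def sum_subtractf[symmetric] by (rule sum_abs)
  also have "\<dots> \<le> (\<Sum>i\<in>{1..n}. 2 * dist_S2n n \<Gamma> \<Delta>)"
    by (intro sum_mono abs_edge_cos_diff_le assms)
  finally show ?thesis by simp
qed

lemma dist_S2n_tendsto_0:
  assumes "n \<ge> 3" "\<Delta> \<in> S2n n" "\<And>i. i \<in> {1..n} \<Longrightarrow> ((\<lambda>t. X t i) \<longlongrightarrow> \<Delta> i) F"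
    and "\<forall>\<^sub>F t in F. X t \<in> S2n n" and "e > 0"
  shows "\<forall>\<^sub>F t in F. dist_S2n n (X t) \<Delta> < e"
proof -
  have "\<forall>\<^sub>F t in F. arccos (X t i \<bullet> \<Delta> i) < e" if i: "i \<in> {1..n}" for i
  proof -
    have "((\<lambda>t. X t i \<bullet> \<Delta> i) \<longlongrightarrow> 1) F"
      using tendsto_inner[OF assms(3)[OF i] tendsto_const, of "\<Delta> i"] S2n_inner_self[OF assms(2) i] by simp
    moreover have "\<forall>\<^sub>F t in F. X t i \<bullet> \<Delta> i \<in> {-1..1}"
      using assms(4) by eventually_elim (use abs_inner_S2n_le[OF _ assms(2) i] in \<open>fastforce simp: abs_le_iff\<close>)
    ultimately have "((\<lambda>t. arccos (X t i \<bullet> \<Delta> i)) \<longlongrightarrow> arccos 1) F"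
      by (intro continuous_on_tendsto_compose[OF continuous_on_arccos']) auto
    then show ?thesis
      using order_tendstoD(2)[of _ "arccos 1" F e] assms(5) by simp
  qed
  then have "\<forall>\<^sub>F t in F. \<forall>i\<in>{1..n}. arccos (X t i \<bullet> \<Delta> i) < e"
    by (intro eventually_ball_finite) auto
  then show ?thesis
    by (simp add: dist_S2n_less_iff assms(1))
qed

lemma bdd_below_dist_S2n:
  assumes "n \<ge> 3" "\<Gamma> \<in> S2n n" "M \<subseteq> S2n n"
  shows "bdd_below (dist_S2n n \<Gamma> ` M)"
  using dist_S2n_nonneg[OF assms(1,2)] assms(3) by (intro bdd_belowI[of _ 0]) auto

lemma dist_set_less_iff:
  assumes "n \<ge> 3" "\<Gamma> \<in> S2n n" "M \<subseteq> S2n n" "M \<noteq> {}"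
  shows "dist_set n M \<Gamma> < e \<longleftrightarrow> (\<exists>\<Delta>\<in>M. dist_S2n n \<Gamma> \<Delta> < e)"
  unfolding dist_set_def
  by (subst cInf_less_iff) (use assms bdd_below_dist_S2n in auto)

lemma dist_set_nonneg:
  assumes "n \<ge> 3" "\<Gamma> \<in> S2n n" "M \<subseteq> S2n n" "M \<noteq> {}"
  shows "dist_set n M \<Gamma> \<ge> 0"
  unfolding dist_set_def using assms dist_S2n_nonneg by (intro cINF_greatest) auto

text \<open>This turns small values of a Lyapunov-type function into proximity to its zero set: a sequence of
  counterexamples would accumulate at a zero. It is used for the dissipation to get convergence, and for the
  energy above its minimum to get stability.\<close>
lemma near_zero_set:
  fixes g :: "(nat \<Rightarrow> real^3) \<Rightarrow> real"
  assumes "n \<ge> 3" "continuous_on (S2n n) g" "\<And>\<Gamma>. \<Gamma> \<in> S2n n \<Longrightarrow> g \<Gamma> \<ge> 0" "e > 0"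
  shows "\<exists>\<eta>>0. \<forall>\<Gamma>\<in>S2n n. g \<Gamma> < \<eta> \<longrightarrow> (\<exists>\<Delta>\<in>S2n n. g \<Delta> = 0 \<and> dist_S2n n \<Gamma> \<Delta> < e)"
proof (rule ccontr)
  assume "\<not> ?thesis"
  then have "\<forall>k. \<exists>\<Gamma>. \<Gamma> \<in> S2n n \<and> g \<Gamma> < inverse (real (Suc k)) \<and>
      \<not> (\<exists>\<Delta>\<in>S2n n. g \<Delta> = 0 \<and> dist_S2n n \<Gamma> \<Delta> < e)"
    by (metis inverse_positive_iff_positive of_nat_0_less_iff zero_less_Suc)
  then obtain X where X: "\<And>k. X k \<in> S2n n" "\<And>k. g (X k) < inverse (real (Suc k))"
      "\<And>k \<Delta>. \<Delta> \<in> S2n n \<Longrightarrow> g \<Delta> = 0 \<Longrightarrow> \<not> dist_S2n n (X k) \<Delta> < e"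
    by metis
  obtain \<Delta> r where \<Delta>: "\<Delta> \<in> S2n n" "strict_mono (r :: nat \<Rightarrow> nat)" "(X \<circ> r) \<longlonglongrightarrow> \<Delta>"
    using compact_S2n[of n, THEN compact_imp_seq_compact] X(1) unfolding seq_compact_def by blast
  have "(\<lambda>k. g ((X \<circ> r) k)) \<longlonglongrightarrow> g \<Delta>"
    by (rule continuous_on_tendsto_compose[OF assms(2) \<Delta>(3,1)]) (simp add: X)
  moreover have "(\<lambda>k. g ((X \<circ> r) k)) \<longlonglongrightarrow> 0"
  proof (rule tendsto_sandwich[OF _ _ tendsto_const])
    show "(\<lambda>k. inverse (real (Suc (r k)))) \<longlonglongrightarrow> 0"
      using LIMSEQ_subseq_LIMSEQ[OF LIMSEQ_inverse_real_of_nat \<Delta>(2)] by (simp add: o_def)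
  qed (use X assms(3) in \<open>auto intro!: always_eventually less_imp_le\<close>)
  ultimately have "g \<Delta> = 0" by (rule LIMSEQ_unique)
  have "((\<lambda>k. (X \<circ> r) k i) \<longlonglongrightarrow> \<Delta> i)" for i
    using continuous_on_tendsto_compose[OF continuous_on_product_coordinates \<Delta>(3), of i] by simp
  then have "\<forall>\<^sub>F k in sequentially. dist_S2n n ((X \<circ> r) k) \<Delta> < e"
    by (intro dist_S2n_tendsto_0 assms(1,4) \<Delta>(1)) (use X in auto)
  then show False
    using X(3)[OF \<Delta>(1) \<open>g \<Delta> = 0\<close>] by (auto simp: eventually_sequentially)
qed

section \<open>Equilibria are planar\<close>

definition orthonormal_pairs :: "((real^3) \<times> (real^3)) set" where
  "orthonormal_pairs = {(a, w). norm a = 1 \<and> norm w = 1 \<and> a \<bullet> w = 0}"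

definition planar_config :: "nat \<Rightarrow> (nat \<Rightarrow> real) \<Rightarrow> (real^3) \<times> (real^3) \<Rightarrow> nat \<Rightarrow> real^3" where
  "planar_config n \<theta> = (\<lambda>(a, w). \<lambda>i\<in>{1..n}. cos (\<theta> i) *\<^sub>R a + sin (\<theta> i) *\<^sub>R w)"

text \<open>The direction of the \<open>i\<close>-th agent in the plane when the first one has direction \<open>0\<close> and
  consecutive agents enclose the angles with cosines \<open>q\<close>, always turning the same way.\<close>
definition turning_angle :: "(nat \<Rightarrow> real) \<Rightarrow> nat \<Rightarrow> real" where
  "turning_angle q i = (\<Sum>j\<in>{1..<i}. arccos (q j))"

lemma planar_inner:
  assumes "(a, w) \<in> orthonormal_pairs"
  shows "(cos s *\<^sub>R a + sin s *\<^sub>R w) \<bullet> (cos t *\<^sub>R a + sin t *\<^sub>R w) = cos (s - t)"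
proof -
  have "a \<bullet> a = 1" "w \<bullet> w = 1" "a \<bullet> w = 0" "w \<bullet> a = 0"
    using assms by (auto simp: orthonormal_pairs_def norm_eq_1 inner_commute)
  then show ?thesis
    by (simp add: inner_add_left inner_add_right cos_diff)
qed

lemma planar_config_inner:
  assumes "p \<in> orthonormal_pairs" "i \<in> {1..n}" "j \<in> {1..n}"
  shows "planar_config n \<theta> p i \<bullet> planar_config n \<theta> p j = cos (\<theta> i - \<theta> j)"
  using assms planar_inner[of "fst p" "snd p"] by (simp add: planar_config_def case_prod_beta)

lemma planar_config_S2n: "p \<in> orthonormal_pairs \<Longrightarrow> planar_config n \<theta> p \<in> S2n n"
  using planar_config_inner[of p _ n _ \<theta>]
  unfolding S2n_def by (auto simp: planar_config_def case_prod_beta norm_eq_1)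

text \<open>The speed depends only on the Gram matrix of the configuration, so isometries preserve equilibria. This
  is how whole fibres, and the star polygons, are shown to consist of equilibria.\<close>
lemma norm_ring_field_sq:
  assumes "n \<ge> 3" "\<Gamma> \<in> S2n n" "i \<in> {1..n}"
  shows "(norm (ring_field n \<Gamma> i))\<^sup>2 = 2 + 2 * (\<Gamma> (prev_idx n i) \<bullet> \<Gamma> (next_idx n i))
           - (\<Gamma> i \<bullet> \<Gamma> (prev_idx n i) + \<Gamma> i \<bullet> \<Gamma> (next_idx n i))\<^sup>2"
proof -
  define x y z where "x = \<Gamma> i" and "y = \<Gamma> (prev_idx n i)" and "z = \<Gamma> (next_idx n i)"
  have 1: "x \<bullet> x = 1" "y \<bullet> y = 1" "z \<bullet> z = 1"
    unfolding x_def y_def z_def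
    by (rule S2n_inner_self[OF assms(2)]; intro assms prev_idx_mem next_idx_mem)+
  have f: "ring_field n \<Gamma> i = (x \<bullet> (y + z)) *\<^sub>R x - (y + z)"
    using cross3_cross3_unit[OF S2n_norm[OF assms(2,3)]]
    by (simp only: ring_field_def sum_ring_nbrs[OF assms(1,3)] x_def y_def z_def)
  have "(norm (ring_field n \<Gamma> i))\<^sup>2 = 2 + 2 * (y \<bullet> z) - (x \<bullet> y + x \<bullet> z)\<^sup>2"
    unfolding f power2_norm_eq_inner
    using 1 by (simp add: inner_commute[of y x] inner_commute[of z x] inner_commute[of z y] algebra_simps power2_eq_square)
  then show ?thesis by (simp add: x_def y_def z_def)
qed

lemma equilibria_gram_cong:
  assumes "n \<ge> 3" "\<Gamma> \<in> equilibria n" "\<Delta> \<in> S2n n"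
    and "\<And>i j. i \<in> {1..n} \<Longrightarrow> j \<in> {1..n} \<Longrightarrow> \<Delta> i \<bullet> \<Delta> j = \<Gamma> i \<bullet> \<Gamma> j"
  shows "\<Delta> \<in> equilibria n"
proof -
  have "(norm (ring_field n \<Delta> i))\<^sup>2 = 0" if i: "i \<in> {1..n}" for i
  proof -
    note m = prev_idx_mem[OF i] next_idx_mem[OF i]
    have G: "\<Gamma> \<in> S2n n" "ring_field n \<Gamma> i = 0" using assms(2) i by (auto simp: equilibria_def)
    have "(norm (ring_field n \<Delta> i))\<^sup>2 = (norm (ring_field n \<Gamma> i))\<^sup>2"
      unfolding norm_ring_field_sq[OF assms(1,3) i] norm_ring_field_sq[OF assms(1) G(1) i]
      using assms(4) i m by presburger
    then show ?thesis using G by simp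
  qed
  then show ?thesis using assms(3) by (simp add: equilibria_def)
qed

lemma equilibrium_next:
  assumes "n \<ge> 3" "\<Gamma> \<in> equilibria n" "i \<in> {1..n}"
  shows "\<Gamma> (next_idx n i) = (edge_cos n \<Gamma> (prev_idx n i) + edge_cos n \<Gamma> i) *\<^sub>R \<Gamma> i - \<Gamma> (prev_idx n i)"
  using ring_field_eq[OF assms(1) _ assms(3), of \<Gamma>] assms(2,3)
  by (auto simp: equilibria_def algebra_simps)

text \<open>Taking norms in \<open>\<Gamma>\<^sub>i\<^sub>+\<^sub>1 = (c\<^sub>i\<^sub>-\<^sub>1 + c\<^sub>i) \<Gamma>\<^sub>i - \<Gamma>\<^sub>i\<^sub>-\<^sub>1\<close> gives \<open>c\<^sub>i = c\<^sub>i\<^sub>-\<^sub>1\<close>, where agent \<open>i\<close> bisects its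
  neighbours, or \<open>c\<^sub>i = - c\<^sub>i\<^sub>-\<^sub>1\<close>, where its neighbours are antipodal.\<close>
lemma equilibrium_edge_cos_sq:
  assumes "n \<ge> 3" "\<Gamma> \<in> equilibria n" "i \<in> {1..n}" "j \<in> {1..n}"
  shows "(edge_cos n \<Gamma> i)\<^sup>2 = (edge_cos n \<Gamma> j)\<^sup>2"
proof -
  have S: "\<Gamma> \<in> S2n n" using assms(2) by (simp add: equilibria_def)
  have prev: "(edge_cos n \<Gamma> k)\<^sup>2 = (edge_cos n \<Gamma> (prev_idx n k))\<^sup>2" if k: "k \<in> {1..n}" for k
  proof -
    define l where "l = edge_cos n \<Gamma> (prev_idx n k) + edge_cos n \<Gamma> k"
    have c: "\<Gamma> (prev_idx n k) \<bullet> \<Gamma> k = edge_cos n \<Gamma> (prev_idx n k)"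
      by (simp only: edge_cos_def next_prev_idx[OF k])
    have "1 = (l *\<^sub>R \<Gamma> k - \<Gamma> (prev_idx n k)) \<bullet> (l *\<^sub>R \<Gamma> k - \<Gamma> (prev_idx n k))"
      using S2n_inner_self[OF S next_idx_mem[OF k]]
      unfolding equilibrium_next[OF assms(1,2) k] l_def by simp
    also have "\<dots> = l * l - 2 * l * edge_cos n \<Gamma> (prev_idx n k) + 1"
      unfolding inner_diff_left inner_diff_right inner_scaleR_left inner_scaleR_right c
        inner_commute[of "\<Gamma> k" "\<Gamma> (prev_idx n k)"] S2n_inner_self[OF S k] S2n_inner_self[OF S prev_idx_mem[OF k]]
      by (simp add: algebra_simps)
    finally have "l * (l - 2 * edge_cos n \<Gamma> (prev_idx n k)) = 0" by algebra
    then have "l = 0 \<or> l = 2 * edge_cos n \<Gamma> (prev_idx n k)"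
      unfolding mult_eq_0_iff by linarith
    then have "edge_cos n \<Gamma> k = - edge_cos n \<Gamma> (prev_idx n k) \<or> edge_cos n \<Gamma> k = edge_cos n \<Gamma> (prev_idx n k)"
      unfolding l_def by linarith
    then show ?thesis by (auto simp: power2_eq_iff)
  qed
  have "(edge_cos n \<Gamma> k)\<^sup>2 = (edge_cos n \<Gamma> 1)\<^sup>2" if "k \<ge> 1" "k \<le> n" for k
    using that
  proof (induction k rule: dec_induct)
    case (step m)
    then show ?case using prev[of "Suc m"] by (simp add: prev_idx_def)
  qed simp
  from this[of i] this[of j] assms(3,4) show ?thesis by (metis atLeastAtMost_iff)
qed

lemma unit_vector_polar:
  fixes a b :: "real^3"
  assumes "norm a = 1" "norm b = 1"
  shows "\<exists>w. (a, w) \<in> orthonormal_pairs \<and>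
    b = cos (arccos (a \<bullet> b)) *\<^sub>R a + sin (arccos (a \<bullet> b)) *\<^sub>R w"
proof -
  define c where "c = a \<bullet> b"
  have c: "\<bar>c\<bar> \<le> 1" unfolding c_def using Cauchy_Schwarz_ineq2[of a b] assms by simp
  then have cs: "cos (arccos c) = c" "sin (arccos c) = sqrt (1 - c\<^sup>2)"
    by (auto simp: sin_arccos_abs)
  have aa: "a \<bullet> a = 1" "b \<bullet> b = 1" "b \<bullet> a = c" using assms by (auto simp: norm_eq_1 c_def inner_commute)
  define d where "d = b - c *\<^sub>R a"
  have ad: "a \<bullet> d = 0" using aa by (simp add: d_def inner_diff_right c_def)
  have "d \<bullet> d = 1 - c\<^sup>2"
    using aa by (simp add: d_def inner_diff_left inner_diff_right power2_eq_square inner_commute[of a b])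
  then have nd: "norm d = sqrt (1 - c\<^sup>2)" by (simp add: norm_eq_sqrt_inner)
  show ?thesis
  proof (cases "d = 0")
    case True
    obtain w0 :: "real^3" where w0: "w0 \<noteq> 0" "orthogonal a w0"
      using orthogonal_to_vector_exists[of a] by (auto simp: orthogonal_commute)
    have "(a, w0 /\<^sub>R norm w0) \<in> orthonormal_pairs"
      using w0 assms by (auto simp: orthonormal_pairs_def orthogonal_def)
    moreover have "sin (arccos c) = 0" "b = c *\<^sub>R a" using True nd cs d_def by auto
    ultimately show ?thesis
      using cs unfolding c_def[symmetric] by (intro exI[of _ "w0 /\<^sub>R norm w0"]) simp
  next
    case False
    have "(a, d /\<^sub>R norm d) \<in> orthonormal_pairs"
      using False ad assms by (auto simp: orthonormal_pairs_def)
    moreover have "b = c *\<^sub>R a + sin (arccos c) *\<^sub>R (d /\<^sub>R norm d)"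
      unfolding cs(2) nd[symmetric] using False by (simp add: d_def)
    ultimately show ?thesis
      using cs unfolding c_def[symmetric] by auto
  qed
qed

lemma turning_angle_Suc: "i \<ge> 1 \<Longrightarrow> turning_angle q (Suc i) = turning_angle q i + arccos (q i)"
  unfolding turning_angle_def by (subst sum.atLeastLessThan_Suc) auto

text \<open>The edge cosines have equal squares, so all edge angles have the same sine. With this the
  recursion \<open>\<Gamma>\<^sub>i\<^sub>+\<^sub>1 = (c\<^sub>i\<^sub>-\<^sub>1 + c\<^sub>i) \<Gamma>\<^sub>i - \<Gamma>\<^sub>i\<^sub>-\<^sub>1\<close> is the addition theorem for the
  next turn by \<open>arccos c\<^sub>i\<close>. After \<open>n\<close> turns the first agent is
  reached again, which is the last conclusion.\<close>
lemma equilibrium_planar: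
  assumes "n \<ge> 3" "\<Gamma> \<in> equilibria n"
  defines "\<theta> \<equiv> turning_angle (edge_cos n \<Gamma>)"
  obtains p where "p \<in> orthonormal_pairs" "\<Gamma> = planar_config n \<theta> p" "cos (\<theta> (n + 1)) = 1"
proof -
  have S: "\<Gamma> \<in> S2n n" using assms(2) by (simp add: equilibria_def)
  have n1: "1 \<in> {1..n}" "Suc 1 \<in> {1..n}" using assms(1) by auto
  define c where "c = edge_cos n \<Gamma>"
  obtain w where w: "(\<Gamma> 1, w) \<in> orthonormal_pairs"
    and \<Gamma>2: "\<Gamma> 2 = cos (arccos (c 1)) *\<^sub>R \<Gamma> 1 + sin (arccos (c 1)) *\<^sub>R w"
    using unit_vector_polar[OF S2n_norm[OF S n1(1)] S2n_norm[OF S n1(2)]] assms(1)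
    by (auto simp: c_def edge_cos_def next_idx_def numeral_2_eq_2)
  define D where "D = (\<lambda>t. cos t *\<^sub>R \<Gamma> 1 + sin t *\<^sub>R w)"
  have c1: "\<bar>c i\<bar> \<le> 1" if "i \<in> {1..n}" for i
    using abs_edge_cos_le_1[OF S that] by (simp add: c_def)
  have turn: "D (\<theta> + arccos x) = (y + x) *\<^sub>R D \<theta> - D (\<theta> - arccos y)"
    if "x\<^sup>2 = y\<^sup>2" "\<bar>x\<bar> \<le> 1" for \<theta> x y
  proof -
    have "\<bar>y\<bar> \<le> 1" using that by (metis power2_eq_iff abs_minus_cancel)
    then have "sin (arccos x) = sin (arccos y)" "cos (arccos x) = x" "cos (arccos y) = y"
      using that by (auto simp: sin_arccos_abs)
    then show ?thesis
      by (simp add: D_def cos_add cos_diff sin_add sin_diff algebra_simps)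
  qed
  have main: "\<Gamma> i = D (\<theta> i) \<and> \<Gamma> (next_idx n i) = D (\<theta> (Suc i))" if "i \<ge> 1" "i \<le> n" for i
    using that
  proof (induction i rule: dec_induct)
    case base
    have "\<theta> 1 = 0" "\<theta> (Suc 1) = arccos (c 1)"
      by (auto simp: \<theta>_def turning_angle_def c_def)
    then show ?case using \<Gamma>2 assms(1) by (simp add: D_def next_idx_def numeral_2_eq_2)
  next
    case (step i)
    have i: "Suc i \<in> {1..n}" "i \<in> {1..n}" using step by auto
    have nx: "next_idx n i = Suc i" "prev_idx n (Suc i) = i"
      using step by (auto simp: next_idx_def prev_idx_def)
    have IH: "\<Gamma> i = D (\<theta> i)" "\<Gamma> (Suc i) = D (\<theta> (Suc i))" using step nx by auto
    have "\<Gamma> (next_idx n (Suc i)) = (c i + c (Suc i)) *\<^sub>R D (\<theta> (Suc i)) - D (\<theta> i)"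
      using equilibrium_next[OF assms(1,2) i(1)] unfolding nx IH c_def .
    also have "\<theta> i = \<theta> (Suc i) - arccos (c i)"
      using step by (simp add: \<theta>_def turning_angle_Suc c_def)
    also have "(c i + c (Suc i)) *\<^sub>R D (\<theta> (Suc i)) - D (\<theta> (Suc i) - arccos (c i))
        = D (\<theta> (Suc i) + arccos (c (Suc i)))"
      using equilibrium_edge_cos_sq[OF assms(1,2) i] c1[OF i(1)] by (intro turn[symmetric]) (auto simp: c_def)
    also have "\<theta> (Suc i) + arccos (c (Suc i)) = \<theta> (Suc (Suc i))"
      by (simp add: \<theta>_def turning_angle_Suc c_def)
    finally show ?case using IH by simp
  qed
  have "\<Gamma> = planar_config n \<theta> (\<Gamma> 1, w)"
  proof
    fix i show "\<Gamma> i = planar_config n \<theta> (\<Gamma> 1, w) i"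
      using main[of i] S by (auto simp: planar_config_def D_def S2n_def PiE_def extensional_def restrict_def)
  qed
  moreover have "\<Gamma> 1 \<bullet> \<Gamma> 1 = \<Gamma> 1 \<bullet> D (\<theta> (Suc n))"
    using main[of n] assms(1) by (simp add: next_idx_def)
  then have "cos (\<theta> (n + 1)) = 1"
    using w S2n_inner_self[OF S n1(1)] by (simp add: D_def inner_add_right orthonormal_pairs_def)
  ultimately show ?thesis using w that by blast
qed

text \<open>A finite superset of the edge cosines of equilibria, which is all that the arguments below need.\<close>
definition equilibrium_cosines :: "nat \<Rightarrow> real set" where
  "equilibrium_cosines n = (\<lambda>(p, q). cos (of_int p * pi / of_int q)) ` ({- int n..int n} \<times> {- int n..int n})"

lemma finite_equilibrium_cosines: "finite (equilibrium_cosines n)"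
  by (simp add: equilibrium_cosines_def)

text \<open>The edge angles are \<open>\<alpha>\<close> or \<open>\<pi> - \<alpha>\<close>. If the first value occurs \<open>k\<close> times then the total turn
  is \<open>(2 k - n) \<alpha> + (n - k) \<pi>\<close>, a multiple of \<open>2 \<pi>\<close>. As \<open>n\<close> is odd, this determines \<open>\<alpha>\<close> up to finitely
  many possibilities.\<close>
lemma edge_cos_mem_equilibrium_cosines:
  assumes "n \<ge> 3" "odd n" "\<Gamma> \<in> equilibria n" "i \<in> {1..n}"
  shows "edge_cos n \<Gamma> i \<in> equilibrium_cosines n"
proof -
  have S: "\<Gamma> \<in> S2n n" using assms(3) by (simp add: equilibria_def)
  define c where "c = edge_cos n \<Gamma>"
  define \<alpha> where "\<alpha> = arccos (c i)"
  have c1: "\<bar>c j\<bar> \<le> 1" if "j \<in> {1..n}" for j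
    using abs_edge_cos_le_1[OF S that] by (simp add: c_def)
  have \<alpha>: "0 \<le> \<alpha>" "\<alpha> \<le> pi" "cos \<alpha> = c i"
    unfolding \<alpha>_def using c1[OF assms(4)] by (auto simp: abs_le_iff arccos_lbound arccos_ubound)
  define K where "K = {j \<in> {1..n}. arccos (c j) = \<alpha>}"
  define k where "k = card K"
  have K: "K \<subseteq> {1..n}" "finite K" by (auto simp: K_def)
  have k: "k \<le> n" unfolding k_def using card_mono[OF _ K(1)] by simp
  have "arccos (c j) = (if j \<in> K then \<alpha> else pi - \<alpha>)" if j: "j \<in> {1..n}" for j
  proof -
    have "(c j)\<^sup>2 = (c i)\<^sup>2" unfolding c_def by (rule equilibrium_edge_cos_sq[OF assms(1,3) j assms(4)])
    then have "c j = c i \<or> c j = - c i" by (simp add: power2_eq_iff)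
    moreover have "arccos (- c i) = pi - \<alpha>"
      unfolding \<alpha>_def using c1[OF assms(4)] by (intro arccos_minus) (auto simp: abs_le_iff)
    ultimately show ?thesis using j by (auto simp: K_def \<alpha>_def)
  qed
  then have "(\<Sum>j\<in>{1..n}. arccos (c j)) = (\<Sum>j\<in>{1..n}. if j \<in> K then \<alpha> else pi - \<alpha>)"
    by (intro sum.cong) auto
  also have "\<dots> = real k * \<alpha> + real (n - k) * (pi - \<alpha>)"
    using K by (simp add: sum.If_cases k_def Int_absorb1 card_Diff_subset flip: Diff_eq)
  finally have sum: "(\<Sum>j\<in>{1..n}. arccos (c j)) = real k * \<alpha> + real (n - k) * (pi - \<alpha>)" .
  obtain p where "cos (turning_angle c (n + 1)) = 1"
    using equilibrium_planar[OF assms(1,3)] unfolding c_def by blast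
  then obtain m :: int where m: "turning_angle c (n + 1) = of_int m * 2 * pi"
    unfolding cos_one_2pi_int by blast
  define r where "r = 2 * m - int (n - k)"
  define q where "q = int k - int (n - k)"
  have "odd (int n)" using assms(2) by simp
  then have q: "q \<noteq> 0" "\<bar>q\<bar> \<le> int n" using k unfolding q_def by presburger+
  have "{1..<n + 1} = {1..n}" by auto
  then have eq: "of_int q * \<alpha> = of_int r * pi"
    using m sum by (simp add: turning_angle_def q_def r_def algebra_simps)
  then have "\<bar>of_int r\<bar> * pi = \<bar>of_int q\<bar> * \<alpha>" using \<alpha> by (metis abs_mult abs_of_nonneg pi_ge_zero)
  also have "\<dots> \<le> real n * pi" using q \<alpha> by (intro mult_mono) linarith+
  finally have r: "\<bar>r\<bar> \<le> int n" by simp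
  have "\<alpha> = of_int r * pi / of_int q" using eq q by (simp add: field_simps)
  then have "c i = cos (of_int r * pi / of_int q)" using \<alpha> by simp
  moreover have "(r, q) \<in> {- int n..int n} \<times> {- int n..int n}" using r q by auto
  ultimately show ?thesis unfolding equilibrium_cosines_def c_def by force
qed

section \<open>The equilibrium manifolds\<close>

definition equilibrium_fibre :: "nat \<Rightarrow> (nat \<Rightarrow> real^3) \<Rightarrow> (nat \<Rightarrow> real^3) set" where
  "equilibrium_fibre n \<Gamma> = {\<Delta> \<in> equilibria n. \<forall>i\<in>{1..n}. edge_cos n \<Delta> i = edge_cos n \<Gamma> i}"

lemma turning_angle_cong:
  "(\<And>j. j \<in> {1..n} \<Longrightarrow> q j = r j) \<Longrightarrow> i \<le> n + 1 \<Longrightarrow> turning_angle q i = turning_angle r i"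
  unfolding turning_angle_def by (intro sum.cong) auto

lemma planar_config_cong:
  "(\<And>i. i \<in> {1..n} \<Longrightarrow> \<theta> i = \<phi> i) \<Longrightarrow> planar_config n \<theta> = planar_config n \<phi>"
  by (auto simp: planar_config_def fun_eq_iff)

lemma equilibrium_fibre_eq_image:
  assumes "n \<ge> 3" "\<Gamma> \<in> equilibria n"
  shows "equilibrium_fibre n \<Gamma> = planar_config n (turning_angle (edge_cos n \<Gamma>)) ` orthonormal_pairs"
    (is "_ = ?F ` _")
proof (intro subset_antisym subsetI)
  fix \<Delta> assume "\<Delta> \<in> equilibrium_fibre n \<Gamma>"
  then have \<Delta>: "\<Delta> \<in> equilibria n" "\<And>i. i \<in> {1..n} \<Longrightarrow> edge_cos n \<Delta> i = edge_cos n \<Gamma> i"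
    by (auto simp: equilibrium_fibre_def)
  obtain p where p: "p \<in> orthonormal_pairs" "\<Delta> = planar_config n (turning_angle (edge_cos n \<Delta>)) p"
    using equilibrium_planar[OF assms(1) \<Delta>(1)] by blast
  have "planar_config n (turning_angle (edge_cos n \<Delta>)) = ?F"
    by (intro planar_config_cong turning_angle_cong[of n]) (use \<Delta> in auto)
  then show "\<Delta> \<in> ?F ` orthonormal_pairs" using p by auto
next
  fix \<Delta> assume "\<Delta> \<in> ?F ` orthonormal_pairs"
  then obtain p where p: "p \<in> orthonormal_pairs" "\<Delta> = ?F p" by auto
  obtain p' where p': "p' \<in> orthonormal_pairs" "\<Gamma> = ?F p'"
    using equilibrium_planar[OF assms] by blast
  have gram: "\<Delta> i \<bullet> \<Delta> j = \<Gamma> i \<bullet> \<Gamma> j" if "i \<in> {1..n}" "j \<in> {1..n}" for i j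
    using planar_config_inner[OF p(1) that] planar_config_inner[OF p'(1) that] p(2) p'(2) by metis
  have "\<Delta> \<in> S2n n" using p planar_config_S2n by simp
  then have "\<Delta> \<in> equilibria n" by (rule equilibria_gram_cong[OF assms _ gram])
  moreover have "edge_cos n \<Delta> i = edge_cos n \<Gamma> i" if "i \<in> {1..n}" for i
    using gram[OF that next_idx_mem[OF that]] by (simp add: edge_cos_def)
  ultimately show "\<Delta> \<in> equilibrium_fibre n \<Gamma>" by (simp add: equilibrium_fibre_def)
qed

text \<open>The circle of unit vectors orthogonal to \<open>a\<close> is connected, because it consists of the
  rotations of any of its elements about \<open>a\<close>, which depend continuously on the angle.\<close>
lemma orthonormal_pairs_rotate:
  assumes "norm a = 1" "(b, a) \<in> orthonormal_pairs" "(b', a) \<in> orthonormal_pairs"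
  shows "\<exists>T. connected T \<and> b \<in> T \<and> b' \<in> T \<and> (\<forall>x\<in>T. (x, a) \<in> orthonormal_pairs)"
proof -
  define R where "R = (\<lambda>t. cos t *\<^sub>R b + sin t *\<^sub>R cross3 a b)"
  have b: "b \<bullet> b = 1" "b \<bullet> a = 0" "b' \<bullet> b' = 1" "b' \<bullet> a = 0" "a \<bullet> a = 1" "a \<bullet> b = 0" "a \<bullet> b' = 0"
    using assms by (auto simp: orthonormal_pairs_def norm_eq_1 inner_commute)
  have ab: "cross3 a b \<bullet> cross3 a b = 1" "b \<bullet> cross3 a b = 0" "cross3 a b \<bullet> a = 0" "cross3 a b \<bullet> b = 0"
    using b by (auto simp: dot_cross_self inner_commute dot_cross)
  have on: "(R t, a) \<in> orthonormal_pairs" for t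
  proof -
    have "R t \<bullet> R t = (cos t)\<^sup>2 + (sin t)\<^sup>2"
      using b ab by (simp add: R_def inner_add_left inner_add_right power2_eq_square)
    moreover have "R t \<bullet> a = 0" using b ab by (simp add: R_def inner_add_left)
    ultimately show ?thesis using assms(1) by (simp add: orthonormal_pairs_def norm_eq_1)
  qed
  define x y where "x = b' \<bullet> b" and "y = b' \<bullet> cross3 a b"
  have b': "b' = x *\<^sub>R b + y *\<^sub>R cross3 a b"
  proof -
    define z where "z = b' - x *\<^sub>R b - y *\<^sub>R cross3 a b"
    have z: "z \<bullet> a = 0" "z \<bullet> b = 0" "z \<bullet> cross3 a b = 0"
      using b ab by (simp_all add: z_def inner_diff_left x_def y_def)
    have "(norm z)\<^sup>2 = (norm (cross3 z (cross3 a b)))\<^sup>2 + (z \<bullet> cross3 a b)\<^sup>2"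
      unfolding norm_cross_dot using ab by (simp add: norm_eq_1[symmetric])
    also have "cross3 z (cross3 a b) = 0" using z by (simp add: Lagrange)
    finally have "z = 0" using z by simp
    then show ?thesis by (simp add: z_def algebra_simps)
  qed
  have "b' \<bullet> b' = x\<^sup>2 + y\<^sup>2"
    unfolding b' using b ab by (simp add: inner_add_left inner_add_right power2_eq_square)
  then obtain t where "x = cos t" "y = sin t"
    using sincos_total_2pi[of x y] b by metis
  then have "b' = R t" using b' by (simp add: R_def)
  moreover have "b = R 0" by (simp add: R_def)
  moreover have "connected (range R)"
    unfolding R_def by (intro connected_continuous_image continuous_intros) auto
  ultimately show ?thesis using on by (intro exI[of _ "range R"]) auto
qed

lemma orthonormal_pairs_swap: "(a, w) \<in> orthonormal_pairs \<longleftrightarrow> (w, a) \<in> orthonormal_pairs"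
  by (auto simp: orthonormal_pairs_def inner_commute)

text \<open>Rotating one vector of a pair about the other one joins \<open>(a, b)\<close> to \<open>(a, m)\<close> to \<open>(a', m)\<close> to
  \<open>(a', b')\<close>, where \<open>m\<close> is orthogonal to both \<open>a\<close> and \<open>a'\<close>.\<close>
lemma connected_orthonormal_pairs: "connected orthonormal_pairs"
proof -
  have turn_fst: "connected_component orthonormal_pairs (b, a) (b', a)"
    if "(b, a) \<in> orthonormal_pairs" "(b', a) \<in> orthonormal_pairs" for a b b'
  proof -
    have "norm a = 1" using that by (simp add: orthonormal_pairs_def)
    from orthonormal_pairs_rotate[OF this that]
    obtain T where T: "connected T" "b \<in> T" "b' \<in> T" "\<And>x. x \<in> T \<Longrightarrow> (x, a) \<in> orthonormal_pairs" by blast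
    have "connected ((\<lambda>x. (x, a)) ` T)"
      by (intro connected_continuous_image continuous_intros T)
    then show ?thesis using T unfolding connected_component_def by blast
  qed
  have turn_snd: "connected_component orthonormal_pairs (a, b) (a, b')"
    if "(a, b) \<in> orthonormal_pairs" "(a, b') \<in> orthonormal_pairs" for a b b'
  proof -
    have "norm a = 1" "(b, a) \<in> orthonormal_pairs" "(b', a) \<in> orthonormal_pairs"
      using that by (auto simp: orthonormal_pairs_def inner_commute)
    from orthonormal_pairs_rotate[OF this]
    obtain T where T: "connected T" "b \<in> T" "b' \<in> T" "\<And>x. x \<in> T \<Longrightarrow> (a, x) \<in> orthonormal_pairs"
      using orthonormal_pairs_swap by blast
    have "connected ((\<lambda>x. (a, x)) ` T)"
      by (intro connected_continuous_image continuous_intros T)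
    then show ?thesis using T unfolding connected_component_def by blast
  qed
  have "connected_component orthonormal_pairs (a, b) (a', b')"
    if p: "(a, b) \<in> orthonormal_pairs" "(a', b') \<in> orthonormal_pairs" for a b a' b'
  proof -
    have "dim {a, a'} \<le> card {a, a'}" by (intro dim_le_card') simp
    also have "\<dots> < DIM(real^3)" by (rule le_less_trans[OF card_insert_le_m1]) auto
    finally obtain m0 where m0: "m0 \<noteq> 0" "\<And>y. y \<in> span {a, a'} \<Longrightarrow> orthogonal m0 y"
      using orthogonal_to_subspace_exists[of "{a, a'}"] by metis
    define m where "m = m0 /\<^sub>R norm m0"
    have "m0 \<bullet> a = 0" "m0 \<bullet> a' = 0"
      using m0(2)[of a] m0(2)[of a'] by (auto simp: span_base orthogonal_def)
    then have m: "(a, m) \<in> orthonormal_pairs" "(a', m) \<in> orthonormal_pairs"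
      using p m0(1) by (auto simp: m_def orthonormal_pairs_def inner_commute)
    show ?thesis
      using turn_snd[OF p(1) m(1)] turn_fst[OF m] turn_snd[OF m(2) p(2)] by (meson connected_component_trans)
  qed
  then show ?thesis unfolding connected_iff_connected_component by auto
qed

lemma continuous_on_planar_config: "continuous_on S (planar_config n \<theta>)"
proof (rule continuous_on_coordinatewise_then_product)
  fix i show "continuous_on S (\<lambda>p. planar_config n \<theta> p i)"
    by (cases "i \<in> {1..n}") (auto simp: planar_config_def case_prod_beta intro!: continuous_intros)
qed

lemma connected_equilibrium_fibre:
  assumes "n \<ge> 3" "\<Gamma> \<in> equilibria n"
  shows "connected (equilibrium_fibre n \<Gamma>)"
  unfolding equilibrium_fibre_eq_image[OF assms]
  by (intro connected_continuous_image continuous_on_planar_config connected_orthonormal_pairs)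

text \<open>A fibre is connected as a continuous image of the orthonormal pairs, and no larger set of
  equilibria is connected, because the edge cosines take finitely many values on equilibria.\<close>
lemma connected_component_equilibria:
  assumes "n \<ge> 3" "odd n" "\<Gamma> \<in> equilibria n"
  shows "connected_component_set (equilibria n) \<Gamma> = equilibrium_fibre n \<Gamma>"
proof
  show "equilibrium_fibre n \<Gamma> \<subseteq> connected_component_set (equilibria n) \<Gamma>"
    by (intro connected_component_maximal connected_equilibrium_fibre assms)
       (use assms in \<open>auto simp: equilibrium_fibre_def\<close>)
  show "connected_component_set (equilibria n) \<Gamma> \<subseteq> equilibrium_fibre n \<Gamma>"
  proof
    fix \<Delta> assume "\<Delta> \<in> connected_component_set (equilibria n) \<Gamma>"
    then obtain T where T: "connected T" "T \<subseteq> equilibria n" "\<Gamma> \<in> T" "\<Delta> \<in> T"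
      by (auto simp: connected_component_def)
    have "edge_cos n \<Delta> i = edge_cos n \<Gamma> i" if i: "i \<in> {1..n}" for i
    proof -
      let ?c = "\<lambda>\<Gamma>. edge_cos n \<Gamma> i"
      have "connected (?c ` T)" by (intro connected_continuous_image continuous_on_edge_cos T)
      moreover have "finite (?c ` T)"
        by (rule finite_subset[OF _ finite_equilibrium_cosines[of n]])
           (use edge_cos_mem_equilibrium_cosines[OF assms(1,2) _ i] T(2) in auto)
      ultimately have "?c ` T = {} \<or> (\<exists>y. ?c ` T = {y})"
        using connected_finite_iff_sing by metis
      then show ?thesis using T(3,4) by (metis empty_iff image_eqI singletonD)
    qed
    then show "\<Delta> \<in> equilibrium_fibre n \<Gamma>" using T unfolding equilibrium_fibre_def by blast
  qed
qed

lemma equilibrium_manifolds_eq: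
  assumes "n \<ge> 3" "odd n"
  shows "equilibrium_manifolds n = equilibrium_fibre n ` equilibria n"
  unfolding equilibrium_manifolds_def components_def
  by (intro image_cong connected_component_equilibria assms refl)

section \<open>The regular star polygons\<close>

lemma hat_powers:
  assumes "norm u = 1"
  shows "((**) (hat u) ^^ (2 * m + 1)) (mat 1) = (-1) ^ m *\<^sub>R hat u"
    and "((**) (hat u) ^^ (2 * m + 2)) (mat 1) = (-1) ^ m *\<^sub>R (hat u ** hat u)"
proof -
  have cube: "hat u ** (hat u ** hat u) = - hat u"
  proof (subst matrix_eq, intro allI)
    fix x :: "real^3"
    have "cross3 u (cross3 u (cross3 u x)) = - cross3 u x"
      unfolding cross3_cross3_unit[OF assms, of "cross3 u x"] by (simp add: dot_cross_self)
    then show "hat u ** (hat u ** hat u) *v x = - hat u *v x"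
      using scaleR_matrix_vector_assoc[of "-1" "hat u" x]
      by (simp add: hat_mult_vec flip: matrix_vector_mul_assoc)
  qed
  show odd: "((**) (hat u) ^^ (2 * m + 1)) (mat 1) = (-1) ^ m *\<^sub>R hat u" for m
  proof (induction m)
    case (Suc m)
    have "((**) (hat u) ^^ (2 * Suc m + 1)) (mat 1) = hat u ** (hat u ** ((**) (hat u) ^^ (2 * m + 1)) (mat 1))"
      by simp
    also have "\<dots> = (-1) ^ m *\<^sub>R (hat u ** (hat u ** hat u))"
      unfolding Suc by (simp only: matrix_scalar_ac scalar_matrix_assoc[symmetric])
    finally show ?case by (simp add: cube)
  qed simp
  show "((**) (hat u) ^^ (2 * m + 2)) (mat 1) = (-1) ^ m *\<^sub>R (hat u ** hat u)"
    using odd[of m] by (simp add: matrix_scalar_ac scalar_matrix_assoc)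
qed

text \<open>Rodrigues' formula: the powers of \<open>hat u\<close> repeat up to sign, so the exponential series splits into
  the series of sine and cosine.\<close>
lemma matrix_exp_hat:
  assumes "norm u = 1"
  shows "matrix_exp (t *\<^sub>R hat u) = sin t *\<^sub>R hat u - cos t *\<^sub>R (hat u ** hat u) + (mat 1 + hat u ** hat u)"
proof -
  let ?H = "hat u"
  have scale: "((**) (t *\<^sub>R ?H) ^^ k) (mat 1) = t ^ k *\<^sub>R ((**) ?H ^^ k) (mat 1)" for k
    by (induction k) (auto simp: matrix_scalar_ac scalar_matrix_assoc mult.commute)
  have coeff: "(1 / fact k) *\<^sub>R ((**) (t *\<^sub>R ?H) ^^ k) (mat 1)
      = (sin_coeff k * t ^ k) *\<^sub>R ?H - (cos_coeff k * t ^ k) *\<^sub>R (?H ** ?H)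
        + (if k = 0 then mat 1 + ?H ** ?H else 0)" for k
  proof -
    consider "k = 0" | m where "k = 2 * m + 1" | m where "k = 2 * m + 2"
      by (metis evenE oddE not0_implies_Suc add_2_eq_Suc' mult_Suc_right add.commute mult_0_right)
    then show ?thesis
    proof cases
      case 1 then show ?thesis by (simp add: sin_coeff_def cos_coeff_def)
    next
      case (2 m) then show ?thesis
        unfolding scale unfolding 2 hat_powers(1)[OF assms]
        by (simp add: sin_coeff_def cos_coeff_def)
    next
      case (3 m) then show ?thesis
        unfolding scale unfolding 3 hat_powers(2)[OF assms]
        by (simp add: sin_coeff_def cos_coeff_def)
    qed
  qed
  have "(\<lambda>k. sin_coeff k * t ^ k) sums sin t" "(\<lambda>k. cos_coeff k * t ^ k) sums cos t"
    using sin_converges[of t] cos_converges[of t] by simp_all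
  then have "(\<lambda>k. (1 / fact k) *\<^sub>R ((**) (t *\<^sub>R ?H) ^^ k) (mat 1)) sums
      (sin t *\<^sub>R ?H - cos t *\<^sub>R (?H ** ?H) + (mat 1 + ?H ** ?H))"
    unfolding coeff
    by (intro sums_add sums_diff sums_scaleR_left sums_single[where i = 0, where f = "\<lambda>_. mat 1 + ?H ** ?H"])
  then show ?thesis unfolding matrix_exp_def by (rule sums_unique[symmetric])
qed

lemma matrix_exp_hat_mult_vec:
  assumes "norm u = 1" "u \<bullet> v = 0"
  shows "matrix_exp (t *\<^sub>R hat u) *v v = cos t *\<^sub>R v + sin t *\<^sub>R cross3 u v"
proof -
  have "cross3 u (cross3 u v) = - v" using assms by (simp add: cross3_cross3_unit)
  then show ?thesis
    unfolding matrix_exp_hat[OF assms(1)]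
    by (simp add: matrix_vector_mult_add_rdistrib matrix_vector_mult_diff_rdistrib hat_mult_vec
        scaleR_matrix_vector_assoc[symmetric] matrix_vector_mul_assoc[symmetric] algebra_simps)
qed

definition star_angle :: "nat \<Rightarrow> real" where
  "star_angle n = pi - pi / real n"

lemma star_angle_bounds: "n \<ge> 3 \<Longrightarrow> 0 \<le> star_angle n" "n \<ge> 3 \<Longrightarrow> star_angle n \<le> pi"
  by (auto simp: star_angle_def field_simps)

text \<open>For odd \<open>n\<close> the total turn \<open>n (\<pi> - \<pi> / n) = (n - 1) \<pi>\<close> is a multiple of \<open>2 \<pi>\<close>, so the star polygon closes
  up.\<close>
lemma cos_star_angle_period:
  assumes "odd n"
  shows "cos (real n * star_angle n - x) = cos x"
proof -
  have "n > 0" using assms by (auto intro: Nat.gr0I)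
  obtain m where m: "n = 2 * m + 1" using assms by (rule oddE)
  have "real n * star_angle n = (real n - 1) * pi"
    using \<open>n > 0\<close> by (simp add: star_angle_def field_simps)
  also have "\<dots> = of_int (int m) * (2 * pi)" by (simp add: m)
  finally have "real n * star_angle n = of_int (int m) * (2 * pi)" .
  then show ?thesis
    unfolding cos_diff by (metis cos_int_2pin sin_int_2pin mult.commute mult_1 mult_zero_left add.right_neutral)
qed

lemma turning_angle_star:
  assumes "n \<ge> 3" "i \<ge> 1"
  shows "turning_angle (\<lambda>_. cos (star_angle n)) i = (real i - 1) * star_angle n"
  using assms by (simp add: turning_angle_def arccos_cos star_angle_bounds of_nat_diff)

text \<open>The axis \<open>u\<close> of the rotations and the first agent \<open>v\<close> correspond to the pair \<open>(v, u \<times> v)\<close>, and a pair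
  \<open>(v, w)\<close> to the axis \<open>v \<times> w\<close>.\<close>
lemma M_o_eq_image:
  assumes "n \<ge> 3"
  shows "M_o n = planar_config n (turning_angle (\<lambda>_. cos (star_angle n))) ` orthonormal_pairs"
proof -
  have conf: "planar_config n (turning_angle (\<lambda>_. cos (star_angle n))) (v, w)
      = (\<lambda>i\<in>{1..n}. cos ((real i - 1) * star_angle n) *\<^sub>R v + sin ((real i - 1) * star_angle n) *\<^sub>R w)" for v w
    unfolding planar_config_def by (auto simp: turning_angle_star[OF assms] fun_eq_iff)
  have rod: "matrix_exp (((real i - 1) * (pi - pi / real n)) *\<^sub>R hat u) *v v
      = cos ((real i - 1) * star_angle n) *\<^sub>R v + sin ((real i - 1) * star_angle n) *\<^sub>R cross3 u v"
    if "norm u = 1" "u \<bullet> v = 0" for u v i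
    unfolding star_angle_def by (rule matrix_exp_hat_mult_vec[OF that])
  show ?thesis
  proof (intro subset_antisym subsetI)
    fix \<Gamma> assume "\<Gamma> \<in> M_o n"
    then obtain u v where uv: "norm u = 1" "norm v = 1" "u \<bullet> v = 0" and S: "\<Gamma> \<in> S2n n"
      and \<Gamma>: "\<And>i. i \<in> {1..n} \<Longrightarrow> \<Gamma> i = matrix_exp (((real i - 1) * (pi - pi / real n)) *\<^sub>R hat u) *v v"
      by (auto simp: M_o_def)
    have "(norm (cross3 u v))\<^sup>2 = 1" using uv by (simp add: norm_cross)
    then have "norm (cross3 u v) = 1" using power2_eq_1_iff norm_ge_zero by (smt (verit))
    then have "(v, cross3 u v) \<in> orthonormal_pairs"
      using uv by (simp add: orthonormal_pairs_def dot_cross_self)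
    moreover have "\<Gamma> = planar_config n (turning_angle (\<lambda>_. cos (star_angle n))) (v, cross3 u v)"
      using S by (auto simp: conf \<Gamma> rod[OF uv(1,3)] fun_eq_iff S2n_def PiE_def extensional_def)
    ultimately show "\<Gamma> \<in> planar_config n (turning_angle (\<lambda>_. cos (star_angle n))) ` orthonormal_pairs" by auto
  next
    fix \<Gamma> assume "\<Gamma> \<in> planar_config n (turning_angle (\<lambda>_. cos (star_angle n))) ` orthonormal_pairs"
    then obtain v w where vw: "(v, w) \<in> orthonormal_pairs"
      and \<Gamma>: "\<Gamma> = planar_config n (turning_angle (\<lambda>_. cos (star_angle n))) (v, w)" by auto
    define u where "u = cross3 v w"
    have v: "norm v = 1" "norm w = 1" "v \<bullet> w = 0" using vw by (auto simp: orthonormal_pairs_def)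
    have "(norm u)\<^sup>2 = 1" using v by (simp add: norm_cross u_def)
    then have u: "norm u = 1" "u \<bullet> v = 0"
      using power2_eq_1_iff norm_ge_zero by (smt (verit), simp add: u_def dot_cross_self)
    have "cross3 u v = - cross3 v (cross3 v w)" unfolding u_def by (rule cross_skew)
    also have "\<dots> = w" using v by (simp add: cross3_cross3_unit)
    finally have "cross3 u v = w" .
    then show "\<Gamma> \<in> M_o n"
      unfolding M_o_def \<Gamma> mem_Collect_eq
      by (intro conjI planar_config_S2n vw bexI[of _ u] bexI[of _ v])
         (use u v in \<open>simp_all add: conf rod[OF u]\<close>)
  qed
qed

lemma M_o_equilibrium:
  assumes "n \<ge> 3" "odd n" "\<Gamma> \<in> M_o n"
  shows "\<Gamma> \<in> equilibria n" and "\<And>i. i \<in> {1..n} \<Longrightarrow> edge_cos n \<Gamma> i = cos (star_angle n)"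
proof -
  let ?b = "star_angle n"
  obtain p where p: "p \<in> orthonormal_pairs" "\<Gamma> = planar_config n (turning_angle (\<lambda>_. cos ?b)) p"
    using assms(3) unfolding M_o_eq_image[OF assms(1)] by auto
  have inner: "\<Gamma> i \<bullet> \<Gamma> j = cos ((real i - real j) * ?b)" if "i \<in> {1..n}" "j \<in> {1..n}" for i j
    using that planar_config_inner[OF p(1) that] turning_angle_star[OF assms(1)]
    by (simp add: p(2) left_diff_distrib)
  have wrap: "cos ((real n - x) * ?b) = cos (x * ?b)" for x
    using cos_star_angle_period[OF assms(2)] by (simp add: left_diff_distrib)
  show ec: "edge_cos n \<Gamma> i = cos ?b" if i: "i \<in> {1..n}" for i
    using inner[OF i next_idx_mem[OF i]] wrap[of 1] by (auto simp: edge_cos_def next_idx_def split: if_splits)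
  have S: "\<Gamma> \<in> S2n n" using p planar_config_S2n by simp
  have "(norm (ring_field n \<Gamma> i))\<^sup>2 = 0" if i: "i \<in> {1..n}" for i
  proof -
    note m = next_idx_mem[OF i] prev_idx_mem[OF i]
    have "real (prev_idx n i) - real (next_idx n i) \<in> {- 2, real n - 2}"
      using i assms(1) by (auto simp: prev_idx_def next_idx_def)
    then have 2: "\<Gamma> (prev_idx n i) \<bullet> \<Gamma> (next_idx n i) = cos (2 * ?b)"
      using inner[OF m(2,1)] wrap[of 2] by auto
    have 1: "\<Gamma> i \<bullet> \<Gamma> (next_idx n i) = cos ?b" using ec[OF i] by (simp add: edge_cos_def)
    have 0: "\<Gamma> i \<bullet> \<Gamma> (prev_idx n i) = cos ?b"
      using ec[OF m(2)] by (simp add: edge_cos_def next_prev_idx[OF i] inner_commute)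
    show ?thesis
      unfolding norm_ring_field_sq[OF assms(1) S i] 0 1 2 by (simp add: cos_double_cos power2_eq_square)
  qed
  then show "\<Gamma> \<in> equilibria n" using S by (simp add: equilibria_def)
qed

lemma M_o_eq_fibre:
  assumes "n \<ge> 3" "odd n" "\<Gamma> \<in> M_o n"
  shows "M_o n = equilibrium_fibre n \<Gamma>"
proof -
  have "planar_config n (turning_angle (edge_cos n \<Gamma>)) = planar_config n (turning_angle (\<lambda>_. cos (star_angle n)))"
    by (intro planar_config_cong turning_angle_cong[of n] M_o_equilibrium(2)[OF assms]) auto
  then show ?thesis
    unfolding equilibrium_fibre_eq_image[OF assms(1) M_o_equilibrium(1)[OF assms]] M_o_eq_image[OF assms(1)] by simp
qed

lemma M_o_nonempty:
  assumes "n \<ge> 3"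
  shows "M_o n \<noteq> {}"
proof -
  have "(axis 1 1, axis 2 1) \<in> orthonormal_pairs"
    by (auto simp: orthonormal_pairs_def inner_axis_axis)
  then show ?thesis unfolding M_o_eq_image[OF assms] by blast
qed

text \<open>An equilateral equilibrium is a regular polygon that closes after \<open>m\<close> rounds. As \<open>n\<close> is odd,
  its angle \<open>2 \<pi> m / n\<close> cannot come closer to \<open>\<pi>\<close> than \<open>\<pi> - \<pi> / n\<close>.\<close>
lemma equilateral_equilibrium:
  assumes "n \<ge> 3" "odd n" "\<Gamma> \<in> equilibria n"
    and eq: "\<And>i. i \<in> {1..n} \<Longrightarrow> edge_cos n \<Gamma> i = c"
    and "\<Gamma> \<notin> M_o n"
  shows "c > cos (star_angle n)"
proof -
  have S: "\<Gamma> \<in> S2n n" using assms(3) by (simp add: equilibria_def)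
  have "\<bar>c\<bar> \<le> 1" using abs_edge_cos_le_1[OF S, of 1] eq[of 1] assms(1) by simp
  then have a: "0 \<le> arccos c" "arccos c \<le> pi" "cos (arccos c) = c"
    by (auto simp: abs_le_iff arccos_lbound arccos_ubound)
  have "turning_angle (edge_cos n \<Gamma>) (n + 1) = turning_angle (\<lambda>_. c) (n + 1)"
    by (intro turning_angle_cong[of n] eq) auto
  also have "\<dots> = real n * arccos c" by (simp add: turning_angle_def)
  finally have "cos (real n * arccos c) = 1"
    using equilibrium_planar[OF assms(1,3)] by metis
  then obtain m :: int where m: "real n * arccos c = of_int m * 2 * pi"
    unfolding cos_one_2pi_int by blast
  have "of_int m * 2 * pi \<le> real n * pi" unfolding m[symmetric] using a by (intro mult_left_mono) auto
  then have "of_int (2 * m) \<le> (of_int (int n) :: real)" by simp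
  then have "2 * m \<le> int n" by (simp only: of_int_le_iff)
  moreover have "odd (int n)" using assms(2) by simp
  ultimately have "2 * m \<le> int n - 1" by presburger
  then have "of_int (2 * m) * pi \<le> of_int (int n - 1) * pi" by (intro mult_right_mono) (simp_all only: of_int_le_iff pi_ge_zero)
  moreover have "real n * star_angle n = (real n - 1) * pi"
    using assms(1) by (simp add: star_angle_def field_simps)
  ultimately have "real n * arccos c \<le> real n * star_angle n"
    using m by simp
  then have le: "arccos c \<le> star_angle n" using assms(1) by simp
  have "arccos c \<noteq> star_angle n"
  proof
    assume "arccos c = star_angle n"
    then have c: "c = cos (star_angle n)" using a by simp
    have "planar_config n (turning_angle (edge_cos n \<Gamma>)) = planar_config n (turning_angle (\<lambda>_. cos (star_angle n)))"
      by (intro planar_config_cong turning_angle_cong[of n]) (use eq c in auto)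
    then have "\<Gamma> \<in> M_o n"
      using equilibrium_planar[OF assms(1,3)] unfolding M_o_eq_image[OF assms(1)] by (metis imageI)
    then show False using assms(5) by simp
  qed
  then have "cos (star_angle n) < cos (arccos c)"
    using le a star_angle_bounds[OF assms(1)] by (intro cos_monotone_0_pi) auto
  then show ?thesis using a by simp
qed

section \<open>Existence of trajectories\<close>

definition clip :: "real^3 \<Rightarrow> real^3" where
  "clip v = v /\<^sub>R max 1 (norm v)"

lemma norm_clip_le: "norm (clip v) \<le> 1"
  by (auto simp: clip_def max_def divide_inverse[symmetric] mult.commute[of "inverse _"])

lemma clip_eq: "norm v \<le> 1 \<Longrightarrow> clip v = v"
  by (simp add: clip_def max_def)

lemma clip_eq_closest_point: "clip v = closest_point (cball 0 1) v"
proof (rule any_closest_point_unique)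
  show "clip v \<in> cball 0 1" using norm_clip_le by simp
  show "closest_point (cball 0 1) v \<in> cball 0 1" by (rule closest_point_in_set) auto
  show "\<forall>z\<in>cball 0 1. dist v (clip v) \<le> dist v z"
  proof
    fix z :: "real^3" assume z: "z \<in> cball 0 1"
    show "dist v (clip v) \<le> dist v z"
    proof (cases "norm v \<le> 1")
      case True then show ?thesis by (simp add: clip_eq)
    next
      case False
      have "v - clip v = (1 - 1 / norm v) *\<^sub>R v"
        using False by (simp add: clip_def max_def scaleR_diff_left divide_inverse)
      moreover have "1 / norm v \<le> 1" using False by (subst divide_le_eq_1) linarith
      ultimately have "norm (v - clip v) = (1 - 1 / norm v) * norm v" by simp
      also have "\<dots> = norm v - 1" using False by (cases "v = 0") (simp_all add: left_diff_distrib)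
      also have "\<dots> \<le> norm (v - z)" using norm_triangle_ineq2[of v z] z by simp
      finally show ?thesis by (simp add: dist_norm)
    qed
  qed
  show "\<forall>z\<in>cball 0 1. dist v (closest_point (cball 0 1) v) \<le> dist v z"
    by (intro ballI closest_point_le) auto
qed auto

lemma clip_lipschitz: "norm (clip x - clip y) \<le> norm (x - y)"
  using closest_point_lipschitz[of "cball 0 1" x y] by (simp add: clip_eq_closest_point dist_norm)

text \<open>Off the spheres the field grows like a cube. Clipping the arguments makes it bounded and
  globally Lipschitz without changing it on the spheres.\<close>
definition clipped_field :: "nat \<Rightarrow> (nat \<Rightarrow> real^3) \<Rightarrow> nat \<Rightarrow> real^3" where
  "clipped_field n x = ring_field n (\<lambda>j. clip (x j))"

lemma norm_clipped_field_le: "n \<ge> 3 \<Longrightarrow> i \<in> {1..n} \<Longrightarrow> norm (clipped_field n x i) \<le> 2"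
  unfolding clipped_field_def by (intro norm_ring_field_le norm_clip_le)

lemma clipped_field_lipschitz:
  assumes "n \<ge> 3" "i \<in> {1..n}" "\<And>j. j \<in> {1..n} \<Longrightarrow> norm (x j - y j) \<le> d"
  shows "norm (clipped_field n x i - clipped_field n y i) \<le> 6 * d"
  unfolding clipped_field_def
  by (intro ring_field_lipschitz assms(1,2) norm_clip_le order.trans[OF clip_lipschitz assms(3)])

lemma continuous_on_clipped_field:
  fixes x :: "real \<Rightarrow> nat \<Rightarrow> real^3"
  assumes "\<And>j. continuous_on S (\<lambda>s. x s j)"
  shows "continuous_on S (\<lambda>s. clipped_field n (x s) i)"
proof -
  have "continuous_on S (\<lambda>s. clip (x s j))" for j
    unfolding clip_def by (intro continuous_intros assms) auto
  then show ?thesis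
    unfolding clipped_field_def ring_field_def by (intro continuous_intros continuous_on_cross)
qed

text \<open>Each agent moves along its velocity, which is orthogonal to its position, so the clipped flow
  preserves the spheres.\<close>
lemma inner_clipped_field: "x i \<bullet> clipped_field n x i = 0"
proof -
  have "clipped_field n x i = (1 / max 1 (norm (x i))) *\<^sub>R
      cross3 (x i) (cross3 (clip (x i)) (\<Sum>j\<in>ring_nbrs n i. clip (x j)))"
    by (simp add: clipped_field_def ring_field_def clip_def[of "x i"] cross_mult_left divide_inverse)
  then show ?thesis by (simp add: dot_cross_self)
qed

lemma ring_field_cong:
  assumes "n \<ge> 3" "i \<in> {1..n}" "\<And>j. j \<in> {1..n} \<Longrightarrow> x j = y j"
  shows "ring_field n x i = ring_field n y i"
  unfolding ring_field_def sum_ring_nbrs[OF assms(1,2)]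
  using assms(3) assms(2) prev_idx_mem[OF assms(2)] next_idx_mem[OF assms(2)] by metis

lemma integral_from_0_has_vector_derivative:
  fixes g :: "real \<Rightarrow> 'a :: banach"
  assumes "continuous_on UNIV g" "t \<ge> 0"
  shows "((\<lambda>t. integral {0..t} g) has_vector_derivative g t) (at t within {0..})"
proof -
  have "((\<lambda>t. integral {0..t} g) has_vector_derivative g t) (at t within {0..t + 1})"
    using assms by (intro integral_has_vector_derivative continuous_on_subset[OF assms(1)]) auto
  moreover have "at t within {0..t + 1} = at t within {0..}"
    by (rule at_within_nhd[of _ "{..<t + 1}"]) auto
  ultimately show ?thesis by simp
qed

text \<open>The right-hand side of the integral equation for \<open>y(t) = exp (-12 t) x(t)\<close>. The Lipschitz
  constant of the clipped field is \<open>6\<close>, and the weight \<open>exp (-12 t)\<close> makes this a contraction with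
  factor \<open>1/2\<close> on the whole half-line at once.\<close>
definition picard :: "nat \<Rightarrow> (nat \<Rightarrow> real^3) \<Rightarrow> (real \<times> nat \<Rightarrow> real^3) \<Rightarrow> real \<times> nat \<Rightarrow> real^3" where
  "picard n \<Gamma> y = (\<lambda>(t, i). if i \<in> {1..n} then
     exp (- 12 * max 0 t) *\<^sub>R (\<Gamma> i + integral {0..max 0 t} (\<lambda>s. clipped_field n (\<lambda>j. exp (12 * s) *\<^sub>R y (s, j)) i))
     else 0)"

lemma continuous_on_picard_integrand:
  assumes "\<And>j. continuous_on UNIV (\<lambda>s. y (s, j))"
  shows "continuous_on S (\<lambda>s. clipped_field n (\<lambda>j. exp (12 * s) *\<^sub>R y (s, j)) i)"
  by (intro continuous_on_clipped_field continuous_intros continuous_on_subset[OF assms]) auto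

lemma continuous_on_picard:
  assumes "\<And>j. continuous_on UNIV (\<lambda>s. y (s, j))"
  shows "continuous_on UNIV (\<lambda>t. picard n \<Gamma> y (t, i))"
proof (cases "i \<in> {1..n}")
  case True
  define g where "g = (\<lambda>s. clipped_field n (\<lambda>j. exp (12 * s) *\<^sub>R y (s, j)) i)"
  have g: "continuous_on UNIV g"
    unfolding g_def by (rule continuous_on_picard_integrand[OF assms])
  have "continuous_on {0..} (\<lambda>t. integral {0..t} g)"
    using integral_from_0_has_vector_derivative[OF g]
    by (auto simp: continuous_on_eq_continuous_within intro: has_vector_derivative_continuous)
  then have "continuous_on UNIV (\<lambda>t. integral {0..max 0 t} g)"
    by (rule continuous_on_compose2) (auto intro!: continuous_intros)
  then have "continuous_on UNIV (\<lambda>t. exp (- 12 * max 0 t) *\<^sub>R (\<Gamma> i + integral {0..max 0 t} g))"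
    by (intro continuous_intros)
  then show ?thesis unfolding picard_def g_def case_prod_conv if_P[OF True] .
qed (auto simp: picard_def)

lemma norm_picard_le:
  assumes "n \<ge> 3" "\<Gamma> \<in> S2n n" "\<And>j. continuous_on UNIV (\<lambda>s. y (s, j))"
  shows "norm (picard n \<Gamma> y p) \<le> 1"
proof -
  obtain t i where p: "p = (t, i)" by (cases p)
  show ?thesis
  proof (cases "i \<in> {1..n}")
    case True
    define t' where "t' = max 0 t"
    define g where "g = (\<lambda>s. clipped_field n (\<lambda>j. exp (12 * s) *\<^sub>R y (s, j)) i)"
    have t': "t' \<ge> 0" by (simp add: t'_def)
    have "norm (integral {0..t'} g) \<le> 2 * (t' - 0)"
      unfolding g_def
      by (intro integral_bound t' continuous_on_picard_integrand assms(3) norm_clipped_field_le assms(1) True)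
    then have "norm (\<Gamma> i + integral {0..t'} g) \<le> 1 + 2 * t'"
      using norm_triangle_ineq[of "\<Gamma> i" "integral {0..t'} g"] S2n_norm[OF assms(2) True] by simp
    also have "\<dots> \<le> exp (12 * t')" using exp_ge_add_one_self[of "12 * t'"] t' by linarith
    finally have "exp (- 12 * t') * norm (\<Gamma> i + integral {0..t'} g) \<le> exp (- 12 * t') * exp (12 * t')"
      by (intro mult_left_mono) auto
    then show ?thesis using True by (simp add: p picard_def g_def t'_def flip: exp_add)
  qed (auto simp: p picard_def)
qed

lemma picard_contraction:
  assumes "n \<ge> 3" and y: "\<And>j. continuous_on UNIV (\<lambda>s. y (s, j))"
    and z: "\<And>j. continuous_on UNIV (\<lambda>s. z (s, j))" and d: "\<And>p. norm (y p - z p) \<le> d"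
  shows "norm (picard n \<Gamma> y p - picard n \<Gamma> z p) \<le> d / 2"
proof -
  obtain t i where p: "p = (t, i)" by (cases p)
  have d0: "d \<ge> 0" using d norm_ge_zero order.trans by blast
  show ?thesis
  proof (cases "i \<in> {1..n}")
    case True
    define t' where "t' = max 0 t"
    have t': "t' \<ge> 0" by (simp add: t'_def)
    define g where "g = (\<lambda>y s. clipped_field n (\<lambda>j. exp (12 * s) *\<^sub>R y (s, j)) i)"
    have g: "g y integrable_on {0..t'}" "g z integrable_on {0..t'}"
      unfolding g_def by (intro integrable_continuous_interval continuous_on_picard_integrand y z)+
    have e: "((\<lambda>s. 6 * (exp (12 * s) * d)) has_integral (exp (12 * t') * d / 2 - exp (12 * 0) * d / 2)) {0..t'}"
      by (rule fundamental_theorem_of_calculus[OF t'])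
         (auto intro!: derivative_eq_intros simp: has_real_derivative_iff_has_vector_derivative[symmetric])
    have "norm (integral {0..t'} (\<lambda>s. g y s - g z s)) \<le> integral {0..t'} (\<lambda>s. 6 * (exp (12 * s) * d))"
    proof (rule integral_norm_bound_integral)
      show "(\<lambda>s. g y s - g z s) integrable_on {0..t'}"
        by (intro integrable_diff g)
      show "(\<lambda>s. 6 * (exp (12 * s) * d)) integrable_on {0..t'}" using e by blast
      fix s
      show "norm (g y s - g z s) \<le> 6 * (exp (12 * s) * d)"
        unfolding g_def
      proof (rule clipped_field_lipschitz[OF assms(1) True])
        fix j
        have "norm (exp (12 * s) *\<^sub>R y (s, j) - exp (12 * s) *\<^sub>R z (s, j)) = exp (12 * s) * norm (y (s, j) - z (s, j))"
          by (simp flip: scaleR_diff_right)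
        then show "norm (exp (12 * s) *\<^sub>R y (s, j) - exp (12 * s) *\<^sub>R z (s, j)) \<le> exp (12 * s) * d"
          using d by simp
      qed
    qed
    also have "\<dots> = (exp (12 * t') - 1) * d / 2" using integral_unique[OF e] by (simp add: algebra_simps diff_divide_distrib)
    also have "\<dots> \<le> exp (12 * t') * d / 2" using d0 by (intro divide_right_mono mult_right_mono) auto
    finally have "exp (- 12 * t') * norm (integral {0..t'} (\<lambda>s. g y s - g z s)) \<le> exp (- 12 * t') * (exp (12 * t') * d / 2)"
      by (intro mult_left_mono) auto
    also have "\<dots> = d / 2" by (simp add: exp_minus)
    also have "integral {0..t'} (\<lambda>s. g y s - g z s) = integral {0..t'} (g y) - integral {0..t'} (g z)"
      by (intro integral_diff g)
    also have "exp (- 12 * t') * norm (integral {0..t'} (g y) - integral {0..t'} (g z))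
        = norm (picard n \<Gamma> y p - picard n \<Gamma> z p)"
      using True by (simp add: p picard_def t'_def g_def flip: scaleR_diff_right)
    finally show ?thesis .
  qed (use d0 in \<open>auto simp: p picard_def\<close>)
qed

text \<open>The Picard iterates from \<open>0\<close> form a telescoping series that is dominated by a geometric one.\<close>
lemma picard_fixed_point:
  assumes "n \<ge> 3" "\<Gamma> \<in> S2n n"
  obtains y where "\<And>j. continuous_on UNIV (\<lambda>s. y (s, j))" "picard n \<Gamma> y = y"
proof -
  define Y where "Y = (\<lambda>k. (picard n \<Gamma> ^^ k) (\<lambda>_. 0))"
  have Y: "Y 0 = (\<lambda>_. 0)" "\<And>k. Y (Suc k) = picard n \<Gamma> (Y k)" by (simp_all add: Y_def)
  have cont: "continuous_on UNIV (\<lambda>s. Y k (s, j))" for k j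
    by (induction k arbitrary: j) (auto simp: Y intro: continuous_on_picard)
  have step: "norm (Y (Suc k) p - Y k p) \<le> (1 / 2) ^ k" for k p
  proof (induction k arbitrary: p)
    case 0
    show ?case using norm_picard_le[OF assms, of "Y 0"] cont[of 0] Y by simp
  next
    case (Suc k)
    have "norm (picard n \<Gamma> (Y (Suc k)) p - picard n \<Gamma> (Y k) p) \<le> (1 / 2) ^ k / 2"
      by (intro picard_contraction assms(1) cont Suc)
    then show ?case unfolding Y(2)[of "Suc k"] Y(2)[of k, symmetric] by simp
  qed
  define y where "y = (\<lambda>p. \<Sum>k. Y (Suc k) p - Y k p)"
  have "uniform_limit UNIV (\<lambda>k p. \<Sum>i<k. Y (Suc i) p - Y i p) y sequentially"
    unfolding y_def by (rule Weierstrass_m_test[of _ _ "\<lambda>k. (1 / 2) ^ k"]) (use step in auto)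
  moreover have "(\<Sum>i<k. Y (Suc i) p - Y i p) = Y k p" for k p
    using sum_lessThan_telescope[of "\<lambda>i. Y i p" k] by (simp add: Y(1))
  ultimately have lim: "uniform_limit UNIV Y y sequentially" by simp
  have cy: "continuous_on UNIV (\<lambda>s. y (s, j))" for j
  proof (rule uniform_limit_theorem)
    show "uniform_limit UNIV (\<lambda>k s. Y k (s, j)) (\<lambda>s. y (s, j)) sequentially"
      using lim by (auto simp: uniform_limit_iff elim!: eventually_mono)
  qed (auto simp: cont)
  have "norm (picard n \<Gamma> y p - y p) \<le> e" if "e > 0" for p e
  proof -
    have "\<forall>\<^sub>F k in sequentially. \<forall>p. dist (Y k p) (y p) < e / 2"
      using uniform_limitD[OF lim, of "e / 2"] that by simp
    then obtain N where N: "\<And>k p. k \<ge> N \<Longrightarrow> norm (Y k p - y p) < e / 2"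
      unfolding eventually_sequentially dist_norm by blast
    have "norm (picard n \<Gamma> (Y N) p - picard n \<Gamma> y p) \<le> e / 2 / 2"
      by (rule picard_contraction[OF assms(1) cont cy less_imp_le[OF N[OF order.refl]]])
    moreover have "norm (picard n \<Gamma> (Y N) p - y p) < e / 2" using N[of "Suc N"] by (simp add: Y)
    moreover have "norm (picard n \<Gamma> y p - y p)
        \<le> norm (picard n \<Gamma> (Y N) p - picard n \<Gamma> y p) + norm (picard n \<Gamma> (Y N) p - y p)"
      by (metis norm_minus_commute norm_triangle_sub norm_diff_triangle_le order.refl)
    ultimately show ?thesis using that by linarith
  qed
  then have "norm (picard n \<Gamma> y p - y p) \<le> 0" for p
    by (rule field_le_epsilon[where y = 0, simplified])
  then have "picard n \<Gamma> y = y" by (simp add: fun_eq_iff)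
  then show ?thesis using that cy by blast
qed

theorem trajectory_exists:
  assumes "n \<ge> 3" "\<Gamma>0 \<in> S2n n"
  obtains \<Gamma> where "trajectory n \<Gamma>" "\<Gamma> 0 = \<Gamma>0"
proof -
  obtain y where y: "\<And>j. continuous_on UNIV (\<lambda>s. y (s, j))" "picard n \<Gamma>0 y = y"
    using picard_fixed_point[OF assms] by metis
  define x where "x = (\<lambda>t j. exp (12 * t) *\<^sub>R y (t, j))"
  have cont: "continuous_on UNIV (\<lambda>s. x s j)" for j
    unfolding x_def by (intro continuous_intros y(1))
  have int: "x t i = \<Gamma>0 i + integral {0..t} (\<lambda>s. clipped_field n (x s) i)" if "t \<ge> 0" "i \<in> {1..n}" for t i
  proof -
    have "x t i = exp (12 * t) *\<^sub>R picard n \<Gamma>0 y (t, i)" unfolding y(2) x_def ..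
    also have "\<dots> = \<Gamma>0 i + integral {0..t} (\<lambda>s. clipped_field n (x s) i)"
      using that by (simp add: picard_def x_def max_def exp_minus)
    finally show ?thesis .
  qed
  have deriv: "((\<lambda>s. x s i) has_vector_derivative clipped_field n (x t) i) (at t within {0..})"
    if "t \<ge> 0" "i \<in> {1..n}" for t i
  proof (rule has_vector_derivative_transform)
    show "((\<lambda>t. \<Gamma>0 i + integral {0..t} (\<lambda>s. clipped_field n (x s) i)) has_vector_derivative clipped_field n (x t) i)
        (at t within {0..})"
      using has_vector_derivative_add[OF has_vector_derivative_const
          integral_from_0_has_vector_derivative[OF continuous_on_clipped_field[OF cont] that(1)]]
      by simp
  qed (use that int in auto)
  have x0: "x 0 i = \<Gamma>0 i" if "i \<in> {1..n}" for i using int[of 0 i] that by simp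
  have norm: "norm (x t i) = 1" if "t \<ge> 0" and i: "i \<in> {1..n}" for t i
  proof -
    have "((\<lambda>s. x s i \<bullet> x s i) has_vector_derivative 0) (at t within {0..})" if "t \<in> {0..}" for t
    proof -
      have "((\<lambda>s. x s i \<bullet> x s i) has_derivative
          (\<lambda>h. x t i \<bullet> (h *\<^sub>R clipped_field n (x t) i) + (h *\<^sub>R clipped_field n (x t) i) \<bullet> x t i)) (at t within {0..})"
        using deriv[of t i] that i unfolding has_vector_derivative_def by (intro has_derivative_inner) auto
      then show ?thesis
        using inner_clipped_field[of "x t" i n]
        by (simp add: has_vector_derivative_def inner_commute)
    qed
    then obtain c where c: "\<And>t. t \<in> {0..} \<Longrightarrow> x t i \<bullet> x t i = c"
      using has_vector_derivative_zero_constant[of "{0..}" "\<lambda>s. x s i \<bullet> x s i"] by auto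
    have "c = 1" using c[of 0] x0[OF i] S2n_inner_self[OF assms(2) i] by simp
    then show ?thesis using c[of t] that by (simp add: norm_eq_1)
  qed
  define \<Gamma> where "\<Gamma> = (\<lambda>t. restrict (x t) {1..n})"
  have "\<Gamma> t \<in> S2n n" if "t \<ge> 0" for t
    using norm that by (auto simp: \<Gamma>_def S2n_def)
  moreover have "((\<lambda>s. \<Gamma> s i) has_vector_derivative ring_field n (\<Gamma> t) i) (at t within {0..})"
    if "t \<ge> 0" "i \<in> {1..n}" for t i
  proof -
    have "clipped_field n (x t) i = ring_field n (\<Gamma> t) i"
      unfolding clipped_field_def using that norm
      by (intro ring_field_cong assms(1)) (auto simp: \<Gamma>_def clip_eq)
    moreover have "(\<lambda>s. \<Gamma> s i) = (\<lambda>s. x s i)" using that by (simp add: \<Gamma>_def)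
    ultimately show ?thesis using deriv[OF that] by simp
  qed
  ultimately have "trajectory n \<Gamma>" unfolding trajectory_def by blast
  moreover have "\<Gamma> 0 = \<Gamma>0"
    using x0 assms(2) by (auto simp: \<Gamma>_def S2n_def PiE_def extensional_def fun_eq_iff)
  ultimately show ?thesis using that by blast
qed

section \<open>Dissipation of energy and convergence\<close>

lemma trajectory_S2n: "trajectory n \<Gamma> \<Longrightarrow> t \<ge> 0 \<Longrightarrow> \<Gamma> t \<in> S2n n"
  by (simp add: trajectory_def)

lemma energy_has_derivative:
  assumes "n \<ge> 3" "trajectory n \<Gamma>" "t \<ge> 0"
  shows "((\<lambda>s. energy n (\<Gamma> s)) has_real_derivative - dissipation n (\<Gamma> t)) (at t within {0..})"
proof -
  let ?f = "ring_field n (\<Gamma> t)" and ?N = "next_idx n" and ?P = "prev_idx n"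
  have S: "\<Gamma> t \<in> S2n n" by (rule trajectory_S2n[OF assms(2,3)])
  have d: "((\<lambda>s. \<Gamma> s i) has_vector_derivative ?f i) (at t within {0..})" if "i \<in> {1..n}" for i
    using assms(2,3) that by (simp add: trajectory_def)
  have "((\<lambda>s. edge_cos n (\<Gamma> s) i) has_vector_derivative (\<Gamma> t i \<bullet> ?f (?N i) + ?f i \<bullet> \<Gamma> t (?N i))) (at t within {0..})"
    if i: "i \<in> {1..n}" for i
    using has_derivative_inner[OF d[OF i, unfolded has_vector_derivative_def]
        d[OF next_idx_mem[OF i], unfolded has_vector_derivative_def]]
    by (simp add: has_vector_derivative_def edge_cos_def algebra_simps)
  then have "((\<lambda>s. energy n (\<Gamma> s)) has_vector_derivative
      (\<Sum>i\<in>{1..n}. \<Gamma> t i \<bullet> ?f (?N i) + ?f i \<bullet> \<Gamma> t (?N i))) (at t within {0..})"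
    unfolding energy_def by (intro has_vector_derivative_sum)
  also have "(\<Sum>i\<in>{1..n}. \<Gamma> t i \<bullet> ?f (?N i) + ?f i \<bullet> \<Gamma> t (?N i))
      = (\<Sum>i\<in>{1..n}. \<Gamma> t (?P i) \<bullet> ?f i + ?f i \<bullet> \<Gamma> t (?N i))"
    unfolding sum.distrib sum_prev_idx[of "\<lambda>j i. \<Gamma> t j \<bullet> ?f i"] ..
  also have "\<dots> = (\<Sum>i\<in>{1..n}. - (norm (?f i))\<^sup>2)"
    by (intro sum.cong refl) (simp add: ring_field_inner[OF assms(1) S, symmetric] inner_add_right inner_commute)
  also have "\<dots> = - dissipation n (\<Gamma> t)" by (simp add: dissipation_def sum_negf)
  finally show ?thesis by (simp add: has_real_derivative_iff_has_vector_derivative)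
qed

lemma energy_mean_value:
  assumes "n \<ge> 3" "trajectory n \<Gamma>" "0 \<le> s" "s < t"
  obtains \<xi> where "s < \<xi>" "\<xi> < t" "energy n (\<Gamma> s) - energy n (\<Gamma> t) = (t - s) * dissipation n (\<Gamma> \<xi>)"
proof -
  have "\<exists>\<xi>\<in>{s<..<t}. energy n (\<Gamma> t) - energy n (\<Gamma> s) = (\<lambda>h. - dissipation n (\<Gamma> \<xi>) * h) (t - s)"
  proof (rule mvt_simple[OF assms(4)])
    fix x assume "s \<le> x" "x \<le> t"
    then have "((\<lambda>s. energy n (\<Gamma> s)) has_real_derivative - dissipation n (\<Gamma> x)) (at x within {s..t})"
      using assms by (intro has_field_derivative_subset[OF energy_has_derivative]) auto
    then show "((\<lambda>s. energy n (\<Gamma> s)) has_derivative (\<lambda>h. - dissipation n (\<Gamma> x) * h)) (at x within {s..t})"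
      unfolding has_field_derivative_def .
  qed
  then show ?thesis using that by (force simp: algebra_simps)
qed

lemma energy_antimono:
  assumes "n \<ge> 3" "trajectory n \<Gamma>" "0 \<le> s" "s \<le> t"
  shows "energy n (\<Gamma> t) \<le> energy n (\<Gamma> s)"
proof (cases "s = t")
  case False
  then obtain \<xi> where "energy n (\<Gamma> s) - energy n (\<Gamma> t) = (t - s) * dissipation n (\<Gamma> \<xi>)"
    using energy_mean_value[OF assms(1-3), of t] assms(4) by auto
  moreover have "(t - s) * dissipation n (\<Gamma> \<xi>) \<ge> 0"
    using assms(4) dissipation_nonneg by (intro mult_nonneg_nonneg) auto
  ultimately show ?thesis by linarith
qed simp

lemma trajectory_lipschitz:
  assumes "n \<ge> 3" "trajectory n \<Gamma>" "0 \<le> s" "0 \<le> t" "i \<in> {1..n}"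
  shows "norm (\<Gamma> s i - \<Gamma> t i) \<le> 2 * \<bar>s - t\<bar>"
proof -
  have "norm (\<Gamma> s i - \<Gamma> t i) \<le> 2 * norm (s - t)"
  proof (rule differentiable_bound[of "{0..}" "\<lambda>s. \<Gamma> s i" "\<lambda>t h. h *\<^sub>R ring_field n (\<Gamma> t) i"])
    fix x :: real assume x: "x \<in> {0..}"
    then show "((\<lambda>s. \<Gamma> s i) has_derivative (\<lambda>h. h *\<^sub>R ring_field n (\<Gamma> x) i)) (at x within {0..})"
      using assms(2,5) by (simp add: trajectory_def has_vector_derivative_def)
    have "norm (ring_field n (\<Gamma> x) i) \<le> 2"
      using S2n_norm[OF trajectory_S2n[OF assms(2)]] x by (intro norm_ring_field_le assms(1,5)) auto
    then show "onorm (\<lambda>h. h *\<^sub>R ring_field n (\<Gamma> x) i) \<le> 2"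
      by (intro onorm_bound) (auto simp: mult.commute[of 2] intro!: mult_left_mono)
  qed (use assms in auto)
  then show ?thesis by simp
qed

lemma dissipation_lipschitz:
  assumes "n \<ge> 3" "trajectory n \<Gamma>" "0 \<le> s" "0 \<le> t"
  shows "\<bar>dissipation n (\<Gamma> s) - dissipation n (\<Gamma> t)\<bar> \<le> 48 * real n * \<bar>s - t\<bar>"
proof -
  have "\<bar>(norm (ring_field n (\<Gamma> s) i))\<^sup>2 - (norm (ring_field n (\<Gamma> t) i))\<^sup>2\<bar> \<le> 48 * \<bar>s - t\<bar>"
    if i: "i \<in> {1..n}" for i
  proof -
    define a b where "a = norm (ring_field n (\<Gamma> s) i)" and "b = norm (ring_field n (\<Gamma> t) i)"
    have S: "norm (\<Gamma> s j) \<le> 1" "norm (\<Gamma> t j) \<le> 1" if "j \<in> {1..n}" for j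
      using S2n_norm[OF trajectory_S2n[OF assms(2)] that] assms(3,4) by auto
    have ab: "a \<le> 2" "b \<le> 2" "a \<ge> 0" "b \<ge> 0"
      unfolding a_def b_def by (auto intro!: norm_ring_field_le assms(1) i S)
    have "\<bar>a - b\<bar> \<le> norm (ring_field n (\<Gamma> s) i - ring_field n (\<Gamma> t) i)"
      unfolding a_def b_def by (rule norm_triangle_ineq3)
    also have "\<dots> \<le> 6 * (2 * \<bar>s - t\<bar>)"
      by (rule ring_field_lipschitz[OF assms(1) i S trajectory_lipschitz[OF assms]])
    finally have "\<bar>a - b\<bar> \<le> 12 * \<bar>s - t\<bar>" by simp
    then have "\<bar>a + b\<bar> * \<bar>a - b\<bar> \<le> 4 * (12 * \<bar>s - t\<bar>)"
      using ab by (intro mult_mono) auto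
    moreover have "a\<^sup>2 - b\<^sup>2 = (a + b) * (a - b)" by (simp add: power2_eq_square algebra_simps)
    ultimately show ?thesis by (simp add: a_def b_def abs_mult)
  qed
  then have "(\<Sum>i\<in>{1..n}. \<bar>(norm (ring_field n (\<Gamma> s) i))\<^sup>2 - (norm (ring_field n (\<Gamma> t) i))\<^sup>2\<bar>) \<le> real n * (48 * \<bar>s - t\<bar>)"
    using sum_bounded_above[of "{1..n}" "\<lambda>i. \<bar>(norm (ring_field n (\<Gamma> s) i))\<^sup>2 - (norm (ring_field n (\<Gamma> t) i))\<^sup>2\<bar>"] by simp
  then have "\<bar>dissipation n (\<Gamma> s) - dissipation n (\<Gamma> t)\<bar> \<le> real n * (48 * \<bar>s - t\<bar>)"
    unfolding dissipation_def sum_subtractf[symmetric] by (rule order.trans[OF sum_abs])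
  then show ?thesis by (simp add: algebra_simps)
qed

text \<open>Barbalat's argument: energy that is dissipated at rate \<open>\<ge> e\<close> at a late time \<open>t\<close> is, by the Lipschitz
  bound, dissipated at rate \<open>\<ge> e / 2\<close> for a time \<open>h\<close> that depends only on \<open>e\<close>, and the remaining energy does
  not allow this.\<close>
lemma dissipation_tendsto_0:
  assumes "n \<ge> 3" "trajectory n \<Gamma>"
  shows "((\<lambda>t. dissipation n (\<Gamma> t)) \<longlongrightarrow> 0) at_top"
proof (rule tendstoI)
  fix e :: real assume e: "e > 0"
  define L where "L = 48 * real n"
  have L: "L > 0" using assms(1) by (simp add: L_def)
  define h where "h = e / (2 * L)"
  have h: "h > 0" "L * h = e / 2" using e L by (auto simp: h_def)
  define \<E> where "\<E> = (\<lambda>t. energy n (\<Gamma> t)) ` {0..}"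
  have bdd: "bdd_below \<E>"
    unfolding \<E>_def using energy_ge[OF trajectory_S2n[OF assms(2)]] by (intro bdd_belowI2) auto
  have "\<E> \<noteq> {}" by (auto simp: \<E>_def)
  have "Inf \<E> < Inf \<E> + h * (e / 2)" using h e by simp
  then obtain v where "v \<in> \<E>" "v < Inf \<E> + h * (e / 2)"
    unfolding cInf_less_iff[OF \<open>\<E> \<noteq> {}\<close> bdd] by blast
  then obtain T where T: "T \<ge> 0" "energy n (\<Gamma> T) < Inf \<E> + h * (e / 2)"
    by (auto simp: \<E>_def)
  have "dissipation n (\<Gamma> t) < e" if t: "t \<ge> T" for t
  proof -
    obtain \<xi> where \<xi>: "t < \<xi>" "\<xi> < t + h"
      "energy n (\<Gamma> t) - energy n (\<Gamma> (t + h)) = (t + h - t) * dissipation n (\<Gamma> \<xi>)"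
      using energy_mean_value[OF assms, of t "t + h"] t T(1) h(1) by auto
    have "energy n (\<Gamma> t) \<le> energy n (\<Gamma> T)" using t T by (intro energy_antimono assms) auto
    moreover have "Inf \<E> \<le> energy n (\<Gamma> (t + h))"
      by (rule cInf_lower[OF _ bdd]) (use t T h in \<open>auto simp: \<E>_def\<close>)
    ultimately have "h * dissipation n (\<Gamma> \<xi>) < h * (e / 2)" using \<xi>(3) T(2) by simp
    then have "dissipation n (\<Gamma> \<xi>) < e / 2" using h by simp
    moreover have "\<bar>dissipation n (\<Gamma> t) - dissipation n (\<Gamma> \<xi>)\<bar> \<le> L * \<bar>t - \<xi>\<bar>"
      unfolding L_def using t T \<xi> by (intro dissipation_lipschitz assms) auto
    moreover have "L * \<bar>t - \<xi>\<bar> \<le> L * h" using \<xi> L by (intro mult_left_mono) auto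
    ultimately show ?thesis using h(2) by linarith
  qed
  then show "\<forall>\<^sub>F t in at_top. dist (dissipation n (\<Gamma> t)) 0 < e"
    using dissipation_nonneg by (auto simp: eventually_at_top_linorder intro!: exI[of _ T])
qed

text \<open>By the intermediate value theorem the function cannot travel between different points of \<open>Q\<close> once it is
  closer to \<open>Q\<close> than half their least distance.\<close>
lemma continuous_near_finite_set_converges:
  fixes g :: "real \<Rightarrow> real"
  assumes "finite Q" "continuous_on {0..} g"
    and near: "\<And>e. e > 0 \<Longrightarrow> \<forall>\<^sub>F t in at_top. \<exists>q\<in>Q. \<bar>g t - q\<bar> < e"
  shows "\<exists>q. (g \<longlongrightarrow> q) at_top"
proof -
  \<comment> \<open>the least distance of different points of \<open>Q\<close>; the element \<open>1\<close> covers the case of fewer than two points\<close>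
  define D where "D = insert 1 ((\<lambda>(a, b). \<bar>a - b\<bar>) ` (Q \<times> Q) - {0})"
  define \<delta> where "\<delta> = Min D"
  have D: "finite D" "D \<noteq> {}" using assms(1) by (auto simp: D_def)
  have \<delta>: "\<delta> > 0" unfolding \<delta>_def using D by (subst Min_gr_iff) (auto simp: D_def)
  have sep: "a = b" if "a \<in> Q" "b \<in> Q" "\<bar>a - b\<bar> < \<delta>" for a b
  proof (rule ccontr)
    assume "a \<noteq> b"
    then have "\<bar>a - b\<bar> \<in> D" using that by (auto simp: D_def)
    then have "\<delta> \<le> \<bar>a - b\<bar>" unfolding \<delta>_def using D by simp
    then show False using that by simp
  qed
  obtain T0 where T0: "\<And>t. t \<ge> T0 \<Longrightarrow> \<exists>q\<in>Q. \<bar>g t - q\<bar> < \<delta> / 2"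
    using near[of "\<delta> / 2"] \<delta> by (auto simp: eventually_at_top_linorder)
  define T where "T = max 0 T0"
  have T: "T \<ge> 0" "\<And>t. t \<ge> T \<Longrightarrow> \<exists>q\<in>Q. \<bar>g t - q\<bar> < \<delta> / 2" using T0 by (auto simp: T_def)
  obtain q where q: "q \<in> Q" "\<bar>g T - q\<bar> < \<delta> / 2" using T(2)[of T] by auto
  \<comment> \<open>to leave the neighbourhood of \<open>q\<close>, the function would have to cross the sphere of radius \<open>\<delta> / 2\<close>\<close>
  have stay: "\<bar>g t - q\<bar> < \<delta> / 2" if t: "t \<ge> T" for t
  proof (rule ccontr)
    assume "\<not> ?thesis"
    then have "\<exists>s\<ge>T. s \<le> t \<and> \<bar>g s - q\<bar> = \<delta> / 2"
      using q t T(1) by (intro IVT' continuous_intros continuous_on_subset[OF assms(2)]) auto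
    then obtain s where s: "s \<ge> T" "\<bar>g s - q\<bar> = \<delta> / 2" by auto
    obtain p where p: "p \<in> Q" "\<bar>g s - p\<bar> < \<delta> / 2" using T(2)[OF s(1)] by auto
    have "p = q" using s p by (intro sep[OF p(1) q(1)]) linarith
    then show False using s p by simp
  qed
  have "(g \<longlongrightarrow> q) at_top"
  proof (rule tendstoI)
    fix e :: real assume "e > 0"
    then have "\<forall>\<^sub>F t in at_top. \<exists>q\<in>Q. \<bar>g t - q\<bar> < min e (\<delta> / 2)" using \<delta> by (intro near) auto
    then show "\<forall>\<^sub>F t in at_top. dist (g t) q < e"
      using eventually_ge_at_top[of T]
    proof eventually_elim
      case (elim t)
      then obtain p where p: "p \<in> Q" "\<bar>g t - p\<bar> < min e (\<delta> / 2)" by auto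
      have "p = q" using stay[OF elim(2)] p by (intro sep[OF p(1) q(1)]) linarith
      then show ?case using p by (simp add: dist_real_def)
    qed
  qed
  then show ?thesis ..
qed

lemma edge_cos_converges:
  assumes "n \<ge> 3" "odd n" "trajectory n \<Gamma>" "i \<in> {1..n}"
  shows "\<exists>q. ((\<lambda>t. edge_cos n (\<Gamma> t) i) \<longlongrightarrow> q) at_top"
proof (rule continuous_near_finite_set_converges[OF finite_equilibrium_cosines[of n]])
  have c: "continuous_on {0..} (\<lambda>t. \<Gamma> t j)" if "j \<in> {1..n}" for j
    unfolding continuous_on_eq_continuous_within
    using assms(3) that unfolding trajectory_def by (meson atLeast_iff has_vector_derivative_continuous)
  show "continuous_on {0..} (\<lambda>t. edge_cos n (\<Gamma> t) i)"
    unfolding edge_cos_def by (intro continuous_intros c next_idx_mem assms(4))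
  fix e :: real assume e: "e > 0"
  obtain \<eta> where \<eta>: "\<eta> > 0" "\<And>x. x \<in> S2n n \<Longrightarrow> dissipation n x < \<eta> \<Longrightarrow>
      \<exists>\<Delta>\<in>S2n n. dissipation n \<Delta> = 0 \<and> dist_S2n n x \<Delta> < e / 2"
    using near_zero_set[OF assms(1) continuous_on_dissipation[where n = n] dissipation_nonneg[where n = n] half_gt_zero[OF e]]
    by blast
  have "\<forall>\<^sub>F t in at_top. dissipation n (\<Gamma> t) < \<eta>"
    using order_tendstoD(2)[OF dissipation_tendsto_0[OF assms(1,3)] \<eta>(1)] .
  then show "\<forall>\<^sub>F t in at_top. \<exists>q\<in>equilibrium_cosines n. \<bar>edge_cos n (\<Gamma> t) i - q\<bar> < e"
    using eventually_ge_at_top[of 0]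
  proof eventually_elim
    case (elim t)
    have S: "\<Gamma> t \<in> S2n n" by (rule trajectory_S2n[OF assms(3) elim(2)])
    obtain \<Delta> where \<Delta>: "\<Delta> \<in> S2n n" "dissipation n \<Delta> = 0" "dist_S2n n (\<Gamma> t) \<Delta> < e / 2"
      using \<eta>(2)[OF S elim(1)] by auto
    have "\<bar>edge_cos n (\<Gamma> t) i - edge_cos n \<Delta> i\<bar> < e"
      using abs_edge_cos_diff_le[OF assms(1) S \<Delta>(1) assms(4)] \<Delta>(3) by linarith
    moreover have "edge_cos n \<Delta> i \<in> equilibrium_cosines n"
      using \<Delta> by (intro edge_cos_mem_equilibrium_cosines assms) (simp add: equilibria_iff_dissipation)
    ultimately show ?case by blast
  qed
qed

theorem trajectory_approaches_manifold:
  assumes "n \<ge> 3" "odd n" "trajectory n \<Gamma>"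
  shows "\<exists>M\<in>equilibrium_manifolds n. approaches n \<Gamma> M"
proof -
  obtain q where q: "\<And>i. i \<in> {1..n} \<Longrightarrow> ((\<lambda>t. edge_cos n (\<Gamma> t) i) \<longlongrightarrow> q i) at_top"
    using edge_cos_converges[OF assms] by metis
  \<comment> \<open>the zero set of this function is a single fibre, and the function tends to \<open>0\<close> along the trajectory\<close>
  define g where "g = (\<lambda>x. dissipation n x + (\<Sum>i\<in>{1..n}. \<bar>edge_cos n x i - q i\<bar>))"
  have g0: "g x \<ge> 0" for x
    unfolding g_def by (intro add_nonneg_nonneg dissipation_nonneg sum_nonneg) auto
  have g_eq_0: "x \<in> equilibria n \<and> (\<forall>i\<in>{1..n}. edge_cos n x i = q i)" if "x \<in> S2n n" "g x = 0" for x
  proof -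
    have s0: "(\<Sum>i\<in>{1..n}. \<bar>edge_cos n x i - q i\<bar>) \<ge> 0" by (intro sum_nonneg) auto
    then have "dissipation n x = 0" "(\<Sum>i\<in>{1..n}. \<bar>edge_cos n x i - q i\<bar>) = 0"
      using that(2) dissipation_nonneg[of n x] unfolding g_def by linarith+
    then show ?thesis using that(1) by (auto simp: equilibria_iff_dissipation sum_nonneg_eq_0_iff)
  qed
  have cont: "continuous_on (S2n n) g"
    unfolding g_def by (intro continuous_intros continuous_on_dissipation continuous_on_edge_cos)
  have "((\<lambda>t. g (\<Gamma> t)) \<longlongrightarrow> 0 + (\<Sum>i\<in>{1..n}. \<bar>q i - q i\<bar>)) at_top"
    unfolding g_def by (intro tendsto_intros dissipation_tendsto_0 assms q)
  then have glim: "((\<lambda>t. g (\<Gamma> t)) \<longlongrightarrow> 0) at_top" by simp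
  have near: "\<forall>\<^sub>F t in at_top. \<exists>\<Delta>\<in>S2n n. g \<Delta> = 0 \<and> dist_S2n n (\<Gamma> t) \<Delta> < e" if "e > 0" for e
  proof -
    obtain \<eta> where \<eta>: "\<eta> > 0" "\<And>x. x \<in> S2n n \<Longrightarrow> g x < \<eta> \<Longrightarrow> \<exists>\<Delta>\<in>S2n n. g \<Delta> = 0 \<and> dist_S2n n x \<Delta> < e"
      using near_zero_set[OF assms(1) cont g0 \<open>e > 0\<close>] by auto
    show ?thesis
      using order_tendstoD(2)[OF glim \<eta>(1)] eventually_ge_at_top[of 0]
      by eventually_elim (use \<eta>(2) trajectory_S2n[OF assms(3)] in auto)
  qed
  have "\<exists>\<Delta>\<in>S2n n. g \<Delta> = 0" using near[of 1] by (auto simp: eventually_at_top_linorder)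
  then obtain \<Delta>0 where \<Delta>0: "\<Delta>0 \<in> equilibria n" "\<And>i. i \<in> {1..n} \<Longrightarrow> edge_cos n \<Delta>0 i = q i"
    using g_eq_0 by blast
  define M where "M = equilibrium_fibre n \<Delta>0"
  have M: "M \<subseteq> S2n n" "M \<noteq> {}" "\<And>x. x \<in> S2n n \<Longrightarrow> g x = 0 \<Longrightarrow> x \<in> M"
    using \<Delta>0 g_eq_0 by (auto simp: M_def equilibrium_fibre_def equilibria_def)
  have "approaches n \<Gamma> M"
    unfolding approaches_def
  proof (rule tendstoI)
    fix e :: real assume "e > 0"
    from near[OF this] show "\<forall>\<^sub>F t in at_top. dist (dist_set n M (\<Gamma> t)) 0 < e"
      using eventually_ge_at_top[of 0]
    proof eventually_elim
      case (elim t)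
      have S: "\<Gamma> t \<in> S2n n" by (rule trajectory_S2n[OF assms(3) elim(2)])
      have "dist_set n M (\<Gamma> t) < e"
        unfolding dist_set_less_iff[OF assms(1) S M(1,2)] using elim(1) M(3) by blast
      then show ?case using dist_set_nonneg[OF assms(1) S M(1,2)] by simp
    qed
  qed
  moreover have "M \<in> equilibrium_manifolds n"
    unfolding equilibrium_manifolds_eq[OF assms(1,2)] M_def using \<Delta>0 by blast
  ultimately show ?thesis by blast
qed

section \<open>Only the star polygons minimize the energy\<close>

text \<open>Moving agent \<open>i\<close> out of the plane of an equilibrium by the angle \<open>arctan (a\<^sub>i r)\<close> changes the energy
  by the quadratic form in the hypothesis times \<open>r\<^sup>2\<close>, up to higher order. As a function of
  \<open>s = r\<^sup>2\<close> the energy is differentiable, and the form is its derivative at \<open>0\<close>.\<close>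
lemma lower_energy_nearby:
  assumes "n \<ge> 3" "\<Gamma> \<in> equilibria n" "e > 0"
    and neg: "(\<Sum>i\<in>{1..n}. a i * a (next_idx n i)
                 - edge_cos n \<Gamma> i * ((a i)\<^sup>2 + (a (next_idx n i))\<^sup>2) / 2) < 0"
  obtains \<Delta> where "\<Delta> \<in> S2n n" "dist_S2n n \<Delta> \<Gamma> < e" "energy n \<Delta> < energy n \<Gamma>"
proof -
  let ?N = "next_idx n"
  have S: "\<Gamma> \<in> S2n n" using assms(2) by (simp add: equilibria_def)
  obtain v w where vw: "(v, w) \<in> orthonormal_pairs"
    and \<Gamma>: "\<Gamma> = planar_config n (turning_angle (edge_cos n \<Gamma>)) (v, w)"
    using equilibrium_planar[OF assms(1,2)] by (metis prod.exhaust)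
  define u where "u = cross3 v w"
  have "(norm u)\<^sup>2 = 1" using vw by (simp add: u_def norm_cross orthonormal_pairs_def)
  then have uu: "u \<bullet> u = 1" by (simp add: power2_norm_eq_inner)
  have "planar_config n \<theta> (v, w) i \<bullet> u = 0" if "i \<in> {1..n}" for \<theta> i
    using that by (simp add: planar_config_def u_def inner_add_left dot_cross_self)
  then have u: "\<Gamma> i \<bullet> u = 0" "u \<bullet> \<Gamma> i = 0" if "i \<in> {1..n}" for i
    using that \<Gamma> by (metis inner_commute)+
  define c where "c = edge_cos n \<Gamma>"
  define X where "X = (\<lambda>s. \<lambda>i\<in>{1..n}. (1 / sqrt (1 + s * (a i)\<^sup>2)) *\<^sub>R (\<Gamma> i + (sqrt s * a i) *\<^sub>R u))"
  define E where "E = (\<lambda>s. \<Sum>i\<in>{1..n}. (c i + s * (a i * a (?N i))) / (sqrt (1 + s * (a i)\<^sup>2) * sqrt (1 + s * (a (?N i))\<^sup>2)))"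
  have pos: "1 + s * (a i)\<^sup>2 > 0" if "s \<ge> 0" for s i
    using that by (simp add: add_pos_nonneg)
  have inner: "X s i \<bullet> X s j = (\<Gamma> i \<bullet> \<Gamma> j + s * (a i * a j)) / (sqrt (1 + s * (a i)\<^sup>2) * sqrt (1 + s * (a j)\<^sup>2))"
    if "s \<ge> 0" "i \<in> {1..n}" "j \<in> {1..n}" for s i j
  proof -
    have "(\<Gamma> i + (sqrt s * a i) *\<^sub>R u) \<bullet> (\<Gamma> j + (sqrt s * a j) *\<^sub>R u) = \<Gamma> i \<bullet> \<Gamma> j + (sqrt s * sqrt s) * (a i * a j)"
      using u that uu by (simp add: inner_add_left inner_add_right)
    then show ?thesis using that by (simp add: X_def)
  qed
  have XS: "X s \<in> S2n n" if "s \<ge> 0" for s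
  proof -
    have "norm (X s i) = 1" if i: "i \<in> {1..n}" for i
    proof -
      have "X s i \<bullet> X s i = (1 + s * (a i * a i)) / (1 + s * (a i)\<^sup>2)"
        using inner[OF \<open>s \<ge> 0\<close> i i] pos[OF \<open>s \<ge> 0\<close>, of i] S2n_inner_self[OF S i] by simp
      then show ?thesis using pos[OF \<open>s \<ge> 0\<close>, of i] by (simp add: norm_eq_1 power2_eq_square)
    qed
    moreover have "X s \<in> extensional {1..n}" by (simp add: X_def)
    ultimately show ?thesis unfolding S2n_def PiE_def Pi_def by simp
  qed
  have energy: "energy n (X s) = E s" if "s \<ge> 0" for s
    unfolding energy_def E_def
  proof (intro sum.cong refl)
    fix i assume i: "i \<in> {1..n}"
    show "edge_cos n (X s) i = (c i + s * (a i * a (?N i))) / (sqrt (1 + s * (a i)\<^sup>2) * sqrt (1 + s * (a (?N i))\<^sup>2))"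
      unfolding edge_cos_def[of n "X s"] inner[OF that i next_idx_mem[OF i]] by (simp add: c_def edge_cos_def)
  qed
  have "(E has_real_derivative (\<Sum>i\<in>{1..n}. a i * a (?N i) - c i * ((a i)\<^sup>2 + (a (?N i))\<^sup>2) / 2)) (at 0)"
    unfolding E_def
  proof (rule DERIV_sum)
    fix i
    show "((\<lambda>s. (c i + s * (a i * a (?N i))) / (sqrt (1 + s * (a i)\<^sup>2) * sqrt (1 + s * (a (?N i))\<^sup>2)))
        has_real_derivative (a i * a (?N i) - c i * ((a i)\<^sup>2 + (a (?N i))\<^sup>2) / 2)) (at 0)"
      by (auto intro!: derivative_eq_intros simp: field_simps)
  qed
  from DERIV_neg_dec_right[OF this] neg obtain d where d: "d > 0" "\<And>h. 0 < h \<Longrightarrow> h < d \<Longrightarrow> E h < E 0"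
    by (auto simp: c_def)
  have "E 0 = energy n \<Gamma>" by (simp add: E_def energy_def c_def)
  then have 1: "\<forall>\<^sub>F s in at_right 0. energy n (X s) < energy n \<Gamma>"
    using d energy by (auto simp: eventually_at_right_field intro!: exI[of _ d])
  have "\<forall>\<^sub>F s in at_right 0. dist_S2n n (X s) \<Gamma> < e"
  proof (rule dist_S2n_tendsto_0[OF assms(1) S _ _ assms(3)])
    show "\<forall>\<^sub>F s in at_right 0. X s \<in> S2n n"
      using XS by (auto simp: eventually_at_right_field intro!: exI[of _ 1])
    fix i assume i: "i \<in> {1..n}"
    have "((\<lambda>s. (1 / sqrt (1 + s * (a i)\<^sup>2)) *\<^sub>R (\<Gamma> i + (sqrt s * a i) *\<^sub>R u))
        \<longlongrightarrow> (1 / sqrt (1 + 0 * (a i)\<^sup>2)) *\<^sub>R (\<Gamma> i + (sqrt 0 * a i) *\<^sub>R u)) (at_right 0)"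
      by (intro tendsto_intros) auto
    then show "((\<lambda>s. X s i) \<longlongrightarrow> \<Gamma> i) (at_right 0)" using i by (simp add: X_def)
  qed
  with 1 have "\<forall>\<^sub>F s in at_right 0. X s \<in> S2n n \<and> dist_S2n n (X s) \<Gamma> < e \<and> energy n (X s) < energy n \<Gamma>"
    using eventually_at_right_less[of "0::real"] by eventually_elim (use XS in auto)
  then have "\<exists>s. X s \<in> S2n n \<and> dist_S2n n (X s) \<Gamma> < e \<and> energy n (X s) < energy n \<Gamma>"
    by (rule eventually_happens'[rotated]) simp
  then show ?thesis using that by blast
qed

text \<open>If some edge has a nonnegative cosine, then its two ends move out of the plane to opposite sides.
  Otherwise all edge cosines equal some \<open>c > cos (\<pi> - \<pi> / n)\<close>, and the form is a multiple of \<open>A - 2 c I\<close>, where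
  \<open>A\<close> is the adjacency matrix of the ring. The displacements are then one coordinate of a star polygon, which is an
  eigenvector of \<open>A\<close> with eigenvalue \<open>2 cos (\<pi> - \<pi> / n)\<close>.\<close>
lemma not_M_o_lower_energy_nearby:
  assumes "n \<ge> 3" "odd n" "\<Gamma> \<in> equilibria n" "\<Gamma> \<notin> M_o n" "e > 0"
  obtains \<Delta> where "\<Delta> \<in> S2n n" "dist_S2n n \<Delta> \<Gamma> < e" "energy n \<Delta> < energy n \<Gamma>"
proof (cases "\<exists>k\<in>{1..n}. edge_cos n \<Gamma> k \<ge> 0")
  case True
  then obtain k where k: "k \<in> {1..n}" "edge_cos n \<Gamma> k \<ge> 0" by blast
  define c where "c = edge_cos n \<Gamma>"
  define l m where "l = next_idx n k" and "m = prev_idx n k"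
  have lm: "l \<in> {1..n}" "m \<in> {1..n}" "l \<noteq> k" "m \<noteq> k" "l \<noteq> m"
    using k(1) assms(1) next_idx_mem[OF k(1)] prev_idx_mem[OF k(1)]
    by (auto simp: l_def m_def next_idx_def prev_idx_def split: if_splits)
  have nx: "next_idx n k = l" "next_idx n m = k" "next_idx n l \<noteq> k" "next_idx n l \<noteq> l"
    using k(1) assms(1) by (auto simp: l_def m_def next_idx_def prev_idx_def split: if_splits)
  have nx': "next_idx n i \<noteq> k" if "i \<in> {1..n}" "i \<noteq> m" for i
    using that prev_next_idx[OF that(1)] by (auto simp: m_def)
  have nx'': "next_idx n i \<noteq> l" if "i \<in> {1..n}" "i \<noteq> k" for i
    using that prev_next_idx[OF that(1)] prev_next_idx[OF k(1)] by (auto simp: l_def)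
  have cge: "c i \<ge> - c k" if "i \<in> {1..n}" for i
  proof -
    have "(c i)\<^sup>2 = (c k)\<^sup>2" unfolding c_def by (rule equilibrium_edge_cos_sq[OF assms(1,3) that k(1)])
    then show ?thesis using k(2) unfolding power2_eq_iff c_def by auto
  qed
  define a :: "nat \<Rightarrow> real" where "a = (\<lambda>i. if i = k then 1 else if i = l then - 1 else 0)"
  have "a i * a (next_idx n i) - c i * ((a i)\<^sup>2 + (a (next_idx n i))\<^sup>2) / 2
      \<le> (if i = k then - 1 - c k else 0) + (if i = l then c k / 2 else 0) + (if i = m then c k / 2 else 0)"
    if i: "i \<in> {1..n}" for i
  proof -
    consider "i = k" | "i = l" | "i = m" | "i \<noteq> k" "i \<noteq> l" "i \<noteq> m" by blast
    then show ?thesis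
    proof cases
      case 1 then show ?thesis using lm nx by (simp add: a_def)
    next
      case 2 then show ?thesis using lm nx cge[OF lm(1)] by (simp add: a_def)
    next
      case 3 then show ?thesis using lm nx cge[OF lm(2)] by (simp add: a_def)
    next
      case 4 then show ?thesis using nx'[OF i] nx''[OF i] by (simp add: a_def)
    qed
  qed
  then have "(\<Sum>i\<in>{1..n}. a i * a (next_idx n i) - c i * ((a i)\<^sup>2 + (a (next_idx n i))\<^sup>2) / 2)
      \<le> (\<Sum>i\<in>{1..n}. (if i = k then - 1 - c k else 0) + (if i = l then c k / 2 else 0) + (if i = m then c k / 2 else 0))"
    by (rule sum_mono)
  also have "\<dots> = - 1" using k(1) lm by (simp add: sum.distrib)
  finally have neg: "(\<Sum>i\<in>{1..n}. a i * a (next_idx n i)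
      - edge_cos n \<Gamma> i * ((a i)\<^sup>2 + (a (next_idx n i))\<^sup>2) / 2) < 0" by (simp add: c_def)
  show ?thesis using lower_energy_nearby[OF assms(1,3,5) neg] that by metis
next
  case False
  have n1: "1 \<in> {1..n}" using assms(1) by simp
  define c where "c = edge_cos n \<Gamma> 1"
  have c: "edge_cos n \<Gamma> i = c" if "i \<in> {1..n}" for i
  proof -
    have "(edge_cos n \<Gamma> i)\<^sup>2 = c\<^sup>2" unfolding c_def by (rule equilibrium_edge_cos_sq[OF assms(1,3) that n1])
    moreover have "edge_cos n \<Gamma> i < 0" "c < 0" using False that n1 unfolding c_def not_le[symmetric] by blast+
    ultimately show ?thesis unfolding power2_eq_iff by auto
  qed
  define b where "b = cos (star_angle n)"
  have bc: "b < c" unfolding b_def by (rule equilateral_equilibrium[OF assms(1,2,3) c assms(4)])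
  obtain \<Delta> where \<Delta>: "\<Delta> \<in> M_o n" using M_o_nonempty[OF assms(1)] by blast
  note eq\<Delta> = M_o_equilibrium[OF assms(1,2) \<Delta>]
  define a where "a = (\<lambda>i. \<Delta> i \<bullet> \<Delta> 1)"
  have rec: "a (next_idx n i) + a (prev_idx n i) = 2 * b * a i" if i: "i \<in> {1..n}" for i
    unfolding a_def equilibrium_next[OF assms(1) eq\<Delta>(1) i] eq\<Delta>(2)[OF i] eq\<Delta>(2)[OF prev_idx_mem[OF i]]
    by (simp add: b_def inner_diff_left)
  have "2 * (\<Sum>i\<in>{1..n}. a i * a (next_idx n i))
      = (\<Sum>i\<in>{1..n}. a i * a (next_idx n i)) + (\<Sum>i\<in>{1..n}. a (prev_idx n i) * a i)"
    unfolding sum_prev_idx[of "\<lambda>j i. a j * a i"] by simp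
  also have "\<dots> = (\<Sum>i\<in>{1..n}. a i * (a (next_idx n i) + a (prev_idx n i)))"
    by (simp add: sum.distrib algebra_simps)
  also have "\<dots> = (\<Sum>i\<in>{1..n}. 2 * b * (a i)\<^sup>2)"
    by (intro sum.cong refl) (simp add: rec power2_eq_square)
  finally have 1: "(\<Sum>i\<in>{1..n}. a i * a (next_idx n i)) = b * (\<Sum>i\<in>{1..n}. (a i)\<^sup>2)"
    by (simp add: sum_distrib_left[symmetric] mult.assoc)
  have 2: "(\<Sum>i\<in>{1..n}. edge_cos n \<Gamma> i * ((a i)\<^sup>2 + (a (next_idx n i))\<^sup>2) / 2) = c * (\<Sum>i\<in>{1..n}. (a i)\<^sup>2)"
  proof -
    have "(\<Sum>i\<in>{1..n}. edge_cos n \<Gamma> i * ((a i)\<^sup>2 + (a (next_idx n i))\<^sup>2) / 2)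
        = (\<Sum>i\<in>{1..n}. c / 2 * (a i)\<^sup>2 + c / 2 * (a (next_idx n i))\<^sup>2)"
      by (intro sum.cong refl) (simp add: c algebra_simps)
    also have "\<dots> = c * (\<Sum>i\<in>{1..n}. (a i)\<^sup>2)"
      unfolding sum.distrib sum_distrib_left[symmetric] sum_next_idx[of "\<lambda>i. (a i)\<^sup>2"] by simp
    finally show ?thesis .
  qed
  have "(a 1)\<^sup>2 = 1" using S2n_inner_self[of \<Delta> n 1] eq\<Delta>(1) n1 by (simp add: a_def equilibria_def)
  then have "(\<Sum>i\<in>{1..n}. (a i)\<^sup>2) \<ge> 1"
    using member_le_sum[of 1 "{1..n}" "\<lambda>i. (a i)\<^sup>2"] n1 by simp
  then have "(b - c) * (\<Sum>i\<in>{1..n}. (a i)\<^sup>2) < 0" using bc by (intro mult_neg_pos) auto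
  then have neg: "(\<Sum>i\<in>{1..n}. a i * a (next_idx n i)
      - edge_cos n \<Gamma> i * ((a i)\<^sup>2 + (a (next_idx n i))\<^sup>2) / 2) < 0"
    unfolding sum_subtractf 1 2 by (simp add: left_diff_distrib)
  show ?thesis using lower_energy_nearby[OF assms(1,3,5) neg] that by metis
qed

text \<open>A minimizer stays a minimizer along its trajectory, so it dissipates nothing.\<close>
lemma energy_minimizer_equilibrium:
  assumes "n \<ge> 3" "\<Gamma>0 \<in> S2n n" "\<And>\<Delta>. \<Delta> \<in> S2n n \<Longrightarrow> energy n \<Gamma>0 \<le> energy n \<Delta>"
  shows "\<Gamma>0 \<in> equilibria n"
proof -
  obtain \<Gamma> where \<Gamma>: "trajectory n \<Gamma>" "\<Gamma> 0 = \<Gamma>0" using trajectory_exists[OF assms(1,2)] .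
  have "dissipation n \<Gamma>0 \<le> 0 + e" if "e > 0" for e
  proof -
    \<comment> \<open>the dissipation varies along a trajectory at a rate of at most \<open>48 n\<close>\<close>
    define t where "t = e / (48 * real n)"
    have t: "t > 0" "48 * real n * t = e" using that assms(1) by (auto simp: t_def)
    obtain \<xi> where \<xi>: "0 < \<xi>" "\<xi> < t" "energy n (\<Gamma> 0) - energy n (\<Gamma> t) = (t - 0) * dissipation n (\<Gamma> \<xi>)"
      using energy_mean_value[OF assms(1) \<Gamma>(1) order.refl t(1)] .
    have "t * dissipation n (\<Gamma> \<xi>) \<le> 0"
      using \<xi>(3) assms(3)[OF trajectory_S2n[OF \<Gamma>(1), of t]] t by (simp add: \<Gamma>(2))
    then have "dissipation n (\<Gamma> \<xi>) \<le> 0" using t by (simp add: mult_le_0_iff)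
    moreover have "\<bar>dissipation n (\<Gamma> 0) - dissipation n (\<Gamma> \<xi>)\<bar> \<le> 48 * real n * \<bar>0 - \<xi>\<bar>"
      using \<xi> by (intro dissipation_lipschitz assms(1) \<Gamma>) auto
    moreover have "48 * real n * \<bar>0 - \<xi>\<bar> \<le> 48 * real n * t" using \<xi> by (intro mult_left_mono) auto
    ultimately show ?thesis unfolding \<Gamma>(2) t(2) by linarith
  qed
  then have "dissipation n \<Gamma>0 \<le> 0" by (rule field_le_epsilon)
  then show ?thesis
    using dissipation_nonneg[of n \<Gamma>0] assms(2) by (simp add: equilibria_iff_dissipation)
qed

lemma energy_M_o:
  assumes "n \<ge> 3" "odd n" "\<Gamma> \<in> M_o n"
  shows "energy n \<Gamma> = real n * cos (star_angle n)"
  unfolding energy_def using M_o_equilibrium(2)[OF assms] by simp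

text \<open>By compactness there is a minimizer. It is an equilibrium and a local minimum, so it lies in \<open>M_o\<close>, and the
  energy is constant there.\<close>
lemma energy_minimum:
  assumes "n \<ge> 3" "odd n" "\<Gamma> \<in> S2n n"
  shows "energy n \<Gamma> \<ge> real n * cos (star_angle n)"
    and "energy n \<Gamma> = real n * cos (star_angle n) \<Longrightarrow> \<Gamma> \<in> M_o n"
proof -
  have min: "\<Delta> \<in> M_o n" if "\<Delta> \<in> S2n n" "\<And>x. x \<in> S2n n \<Longrightarrow> energy n \<Delta> \<le> energy n x" for \<Delta>
  proof (rule ccontr)
    assume "\<Delta> \<notin> M_o n"
    moreover have "\<Delta> \<in> equilibria n" by (rule energy_minimizer_equilibrium[OF assms(1) that])
    ultimately obtain x where "x \<in> S2n n" "energy n x < energy n \<Delta>"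
      using not_M_o_lower_energy_nearby[OF assms(1,2), of \<Delta> 1] by auto
    then show False using that(2)[of x] by simp
  qed
  obtain \<Delta> where \<Delta>: "\<Delta> \<in> S2n n" "\<And>x. x \<in> S2n n \<Longrightarrow> energy n \<Delta> \<le> energy n x"
    using continuous_attains_inf[OF compact_S2n _ continuous_on_energy] assms(3) by blast
  have E: "energy n \<Delta> = real n * cos (star_angle n)" by (rule energy_M_o[OF assms(1,2) min[OF \<Delta>]])
  show "energy n \<Gamma> \<ge> real n * cos (star_angle n)" using \<Delta>(2)[OF assms(3)] E by simp
  show "\<Gamma> \<in> M_o n" if "energy n \<Gamma> = real n * cos (star_angle n)"
    using that E \<Delta>(2) by (intro min assms(3)) simp
qed

section \<open>Stability\<close>

lemma M_o_subset: "M_o n \<subseteq> S2n n"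
  by (auto simp: M_o_def)

lemma M_o_stable:
  assumes "n \<ge> 3" "odd n"
  shows "is_stable n (M_o n)"
proof -
  define b where "b = real n * cos (star_angle n)"
  note ne = M_o_subset[of n] M_o_nonempty[OF assms(1)]
  have "positively_invariant n (M_o n)"
    unfolding positively_invariant_def
  proof (intro allI impI)
    fix \<Gamma> and t :: real assume \<Gamma>: "trajectory n \<Gamma>" "\<Gamma> 0 \<in> M_o n" "0 \<le> t"
    have S: "\<Gamma> t \<in> S2n n" by (rule trajectory_S2n[OF \<Gamma>(1,3)])
    have "energy n (\<Gamma> t) \<le> b"
      using energy_antimono[OF assms(1) \<Gamma>(1) order.refl \<Gamma>(3)] energy_M_o[OF assms \<Gamma>(2)] by (simp add: b_def)
    then show "\<Gamma> t \<in> M_o n"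
      using energy_minimum[OF assms S] by (simp add: b_def)
  qed
  moreover have "\<exists>\<delta>>0. \<forall>\<Gamma>. trajectory n \<Gamma> \<longrightarrow> dist_set n (M_o n) (\<Gamma> 0) < \<delta> \<longrightarrow>
      (\<forall>t\<ge>0. dist_set n (M_o n) (\<Gamma> t) < \<epsilon>)" if "\<epsilon> > 0" for \<epsilon>
  proof -
    have "continuous_on (S2n n) (\<lambda>x. energy n x - b)"
      by (intro continuous_intros continuous_on_energy)
    from near_zero_set[OF assms(1) this _ that] energy_minimum(1)[OF assms]
    obtain \<eta> where \<eta>: "\<eta> > 0"
      "\<And>x. x \<in> S2n n \<Longrightarrow> energy n x - b < \<eta> \<Longrightarrow> \<exists>\<Delta>\<in>S2n n. energy n \<Delta> - b = 0 \<and> dist_S2n n x \<Delta> < \<epsilon>"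
      by (auto simp: b_def)
    \<comment> \<open>the energy is Lipschitz with constant \<open>2 n\<close>\<close>
    define \<delta> where "\<delta> = \<eta> / (2 * real n)"
    have \<delta>: "\<delta> > 0" "2 * real n * \<delta> = \<eta>" using \<eta>(1) assms(1) by (auto simp: \<delta>_def)
    have "dist_set n (M_o n) (\<Gamma> t) < \<epsilon>"
      if \<Gamma>: "trajectory n \<Gamma>" "dist_set n (M_o n) (\<Gamma> 0) < \<delta>" "t \<ge> 0" for \<Gamma> t
    proof -
      have S: "\<Gamma> 0 \<in> S2n n" "\<Gamma> t \<in> S2n n" using trajectory_S2n[OF \<Gamma>(1)] \<Gamma>(3) by auto
      obtain \<Delta> where \<Delta>: "\<Delta> \<in> M_o n" "dist_S2n n (\<Gamma> 0) \<Delta> < \<delta>"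
        using \<Gamma>(2) unfolding dist_set_less_iff[OF assms(1) S(1) ne] by blast
      have "energy n (\<Gamma> 0) - b \<le> 2 * real n * dist_S2n n (\<Gamma> 0) \<Delta>"
        using abs_energy_diff_le[OF assms(1) S(1) subsetD[OF M_o_subset \<Delta>(1)]] energy_M_o[OF assms \<Delta>(1)]
        by (simp add: b_def)
      also have "\<dots> < 2 * real n * \<delta>" using \<Delta>(2) assms(1) by (intro mult_strict_left_mono) auto
      finally have "energy n (\<Gamma> t) - b < \<eta>"
        using energy_antimono[OF assms(1) \<Gamma>(1) order.refl \<Gamma>(3)] \<delta>(2) by simp
      from \<eta>(2)[OF S(2) this] obtain \<Delta>' where \<Delta>': "\<Delta>' \<in> S2n n" "energy n \<Delta>' = b" "dist_S2n n (\<Gamma> t) \<Delta>' < \<epsilon>"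
        by auto
      have "\<Delta>' \<in> M_o n" using energy_minimum(2)[OF assms \<Delta>'(1)] \<Delta>'(2) by (simp add: b_def)
      then show ?thesis unfolding dist_set_less_iff[OF assms(1) S(2) ne] using \<Delta>'(3) by blast
    qed
    then show ?thesis using \<delta>(1) by blast
  qed
  ultimately show ?thesis unfolding is_stable_def by blast
qed

lemma finite_energy_equilibria:
  assumes "n \<ge> 3" "odd n"
  shows "finite (energy n ` equilibria n)"
proof (rule finite_subset)
  show "energy n ` equilibria n \<subseteq> (\<lambda>q. \<Sum>i\<in>{1..n}. q i) ` PiE {1..n} (\<lambda>_. equilibrium_cosines n)"
  proof
    fix v assume "v \<in> energy n ` equilibria n"
    then obtain \<Gamma> where \<Gamma>: "\<Gamma> \<in> equilibria n" "v = energy n \<Gamma>" by blast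
    have "v = (\<Sum>i\<in>{1..n}. restrict (edge_cos n \<Gamma>) {1..n} i)" by (simp add: \<Gamma>(2) energy_def)
    moreover have "restrict (edge_cos n \<Gamma>) {1..n} \<in> PiE {1..n} (\<lambda>_. equilibrium_cosines n)"
      using edge_cos_mem_equilibrium_cosines[OF assms \<Gamma>(1)] by (auto simp: PiE_def)
    ultimately show "v \<in> (\<lambda>q. \<Sum>i\<in>{1..n}. q i) ` PiE {1..n} (\<lambda>_. equilibrium_cosines n)" by blast
  qed
  show "finite ((\<lambda>q. \<Sum>i\<in>{1..n}. q i) ` PiE {1..n} (\<lambda>_. equilibrium_cosines n))"
    by (intro finite_imageI finite_PiE finite_equilibrium_cosines) auto
qed

lemma energy_fibre: "\<Delta> \<in> equilibrium_fibre n \<Gamma> \<Longrightarrow> energy n \<Delta> = energy n \<Gamma>"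
  by (simp add: equilibrium_fibre_def energy_def)

lemma energy_near_fibre:
  assumes "n \<ge> 3" "\<Gamma> \<in> equilibria n" "x \<in> S2n n" "dist_set n (equilibrium_fibre n \<Gamma>) x < e"
  shows "\<bar>energy n x - energy n \<Gamma>\<bar> < 2 * real n * e"
proof -
  have sub: "equilibrium_fibre n \<Gamma> \<subseteq> S2n n" "equilibrium_fibre n \<Gamma> \<noteq> {}"
    using assms(2) by (auto simp: equilibrium_fibre_def equilibria_def)
  obtain \<Delta> where \<Delta>: "\<Delta> \<in> equilibrium_fibre n \<Gamma>" "dist_S2n n x \<Delta> < e"
    using assms(4) unfolding dist_set_less_iff[OF assms(1,3) sub] by blast
  have "\<bar>energy n x - energy n \<Delta>\<bar> \<le> 2 * real n * dist_S2n n x \<Delta>"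
    using \<Delta>(1) sub by (intro abs_energy_diff_le assms) auto
  also have "\<dots> < 2 * real n * e" using \<Delta>(2) assms(1) by (intro mult_strict_left_mono) auto
  finally show ?thesis using energy_fibre[OF \<Delta>(1)] by simp
qed

text \<open>A trajectory that starts close to the fibre with less energy can only approach a fibre of less energy. As
  equilibria have finitely many energies, the loss is at least a fixed \<open>\<gamma>\<close>. But inside the
  \<open>\<epsilon>\<close>-neighbourhood of the fibre the energy differs by less than \<open>\<gamma> / 2\<close>.\<close>
lemma not_M_o_unstable:
  assumes "n \<ge> 3" "odd n" "\<Gamma>0 \<in> equilibria n" "\<Gamma>0 \<notin> M_o n"
  shows "\<not> is_stable n (equilibrium_fibre n \<Gamma>0)"
proof
  let ?M = "equilibrium_fibre n \<Gamma>0"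
  assume stable: "is_stable n ?M"
  have n: "real n > 0" using assms(1) by simp
  define V where "V = energy n \<Gamma>0"
  define F where "F = {v \<in> energy n ` equilibria n. v < V}"
  \<comment> \<open>the gap below \<open>V\<close> in the set of equilibrium energies; the element \<open>1\<close> covers the case that \<open>V\<close> is the least one\<close>
  define \<gamma> where "\<gamma> = Min (insert 1 ((\<lambda>v. V - v) ` F))"
  have F: "finite F" unfolding F_def using finite_energy_equilibria[OF assms(1,2)] by simp
  have \<gamma>: "\<gamma> > 0" unfolding \<gamma>_def using F by (subst Min_gr_iff) (auto simp: F_def)
  have gap: "v \<le> V - \<gamma>" if "v \<in> F" for v
  proof -
    have "\<gamma> \<le> V - v" unfolding \<gamma>_def using F that by (intro Min_le) auto
    then show ?thesis by simp
  qed
  define \<epsilon> where "\<epsilon> = \<gamma> / (4 * real n)"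
  have \<epsilon>: "\<epsilon> > 0" "2 * real n * \<epsilon> = \<gamma> / 2" using \<gamma> n by (auto simp: \<epsilon>_def)
  obtain \<delta> where \<delta>: "\<delta> > 0" "\<And>\<Gamma> t. trajectory n \<Gamma> \<Longrightarrow> dist_set n ?M (\<Gamma> 0) < \<delta> \<Longrightarrow> t \<ge> 0 \<Longrightarrow> dist_set n ?M (\<Gamma> t) < \<epsilon>"
    using stable \<epsilon>(1) unfolding is_stable_def by blast
  obtain \<Delta> where \<Delta>: "\<Delta> \<in> S2n n" "dist_S2n n \<Delta> \<Gamma>0 < \<delta>" "energy n \<Delta> < V"
    using not_M_o_lower_energy_nearby[OF assms \<delta>(1)] unfolding V_def by metis
  obtain \<Gamma> where \<Gamma>: "trajectory n \<Gamma>" "\<Gamma> 0 = \<Delta>" using trajectory_exists[OF assms(1) \<Delta>(1)] .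
  have M: "?M \<subseteq> S2n n" "\<Gamma>0 \<in> ?M"
    using assms(3) by (auto simp: equilibrium_fibre_def equilibria_def)
  have "dist_set n ?M (\<Gamma> 0) < \<delta>"
    using dist_set_less_iff[OF assms(1) \<Delta>(1) M(1)] M(2) \<Delta>(2) \<Gamma>(2) by blast
  note close = \<delta>(2)[OF \<Gamma>(1) this]
  obtain \<Gamma>' where \<Gamma>': "\<Gamma>' \<in> equilibria n" "approaches n \<Gamma> (equilibrium_fibre n \<Gamma>')"
    using trajectory_approaches_manifold[OF assms(1,2) \<Gamma>(1)]
    unfolding equilibrium_manifolds_eq[OF assms(1,2)] by blast
  \<comment> \<open>close enough to the limit fibre that its energy is below \<open>V\<close> and above \<open>V - \<gamma>\<close>\<close>
  define e where "e = min \<gamma> (V - energy n \<Delta>) / (8 * real n)"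
  have e: "e > 0" using \<gamma> \<Delta>(3) n by (simp add: e_def)
  have e8: "8 * real n * e = min \<gamma> (V - energy n \<Delta>)" using n by (simp add: e_def)
  have "\<forall>\<^sub>F t in at_top. dist_set n (equilibrium_fibre n \<Gamma>') (\<Gamma> t) < e \<and> t \<ge> 0"
    using order_tendstoD(2)[OF \<Gamma>'(2)[unfolded approaches_def] e] eventually_ge_at_top[of 0]
    by eventually_elim simp
  then obtain t where t: "dist_set n (equilibrium_fibre n \<Gamma>') (\<Gamma> t) < e" "t \<ge> 0"
    by (auto simp: eventually_at_top_linorder)
  have S: "\<Gamma> t \<in> S2n n" by (rule trajectory_S2n[OF \<Gamma>(1) t(2)])
  have 1: "\<bar>energy n (\<Gamma> t) - energy n \<Gamma>'\<bar> < 2 * real n * e"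
    by (rule energy_near_fibre[OF assms(1) \<Gamma>'(1) S t(1)])
  have 2: "\<bar>energy n (\<Gamma> t) - V\<bar> < \<gamma> / 2"
    using energy_near_fibre[OF assms(1,3) S close[OF t(2)]] unfolding V_def \<epsilon>(2) .
  have 3: "energy n (\<Gamma> t) \<le> energy n \<Delta>"
    using energy_antimono[OF assms(1) \<Gamma>(1) order.refl t(2)] \<Gamma>(2) by simp
  have "energy n \<Gamma>' < V" using 1 3 e8 \<Delta>(3) by linarith
  then have "energy n \<Gamma>' \<le> V - \<gamma>" using \<Gamma>'(1) by (intro gap) (auto simp: F_def)
  moreover have "energy n \<Gamma>' > V - \<gamma>" using 1 2 e8 \<gamma> by linarith
  ultimately show False by simp
qed

theorem theorem5p5:
  fixes n :: nat
  assumes "n \<ge> 3" and "odd n"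
  shows "(\<forall>\<Gamma>. trajectory n \<Gamma> \<longrightarrow> (\<exists>M\<in>equilibrium_manifolds n. approaches n \<Gamma> M)) \<and>
         M_o n \<in> equilibrium_manifolds n \<and>
         (\<forall>M\<in>equilibrium_manifolds n. is_stable n M \<longleftrightarrow> M = M_o n)"
proof (intro conjI allI impI ballI)
  show "\<exists>M\<in>equilibrium_manifolds n. approaches n \<Gamma> M" if "trajectory n \<Gamma>" for \<Gamma>
    by (rule trajectory_approaches_manifold[OF assms that])
  obtain \<Delta> where "\<Delta> \<in> M_o n" using M_o_nonempty[OF assms(1)] by blast
  then show "M_o n \<in> equilibrium_manifolds n"
    unfolding equilibrium_manifolds_eq[OF assms]
    using M_o_eq_fibre[OF assms] M_o_equilibrium(1)[OF assms] by blast
  fix M assume "M \<in> equilibrium_manifolds n"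
  then obtain \<Gamma> where \<Gamma>: "\<Gamma> \<in> equilibria n" "M = equilibrium_fibre n \<Gamma>"
    unfolding equilibrium_manifolds_eq[OF assms] by blast
  show "is_stable n M \<longleftrightarrow> M = M_o n"
  proof
    assume "is_stable n M"
    then have "\<Gamma> \<in> M_o n" using not_M_o_unstable[OF assms \<Gamma>(1)] \<Gamma>(2) by blast
    then show "M = M_o n" using M_o_eq_fibre[OF assms] \<Gamma>(2) by simp
  qed (use M_o_stable[OF assms] in simp)
qed

end
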